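(* Let $X^{sk}$ be a $2n\times2n$ generic skew symmetric matrix. Then $$2^{2n-2}\le cr(Pf(X^{sk}))\le 2^{2n-1}.$$
   Context: Let $\mathsf k$ be a field of characteristic zero or of characteristic $p>2$. Let $X^{sk}=(x_{ij})$ be the $2n\times2n$ generic skew symmetric matrix ($x_{ij}=-x_{ji}$, zero diagonal), the $x_{ij}$ with $i<j$ being independent variables; $R^{sk}=\mathsf k[x_{ij}: i<j]$, $S^{sk}=\mathsf k[y_{ij}: i<j]$. $S^{sk}$ acts on $R^{sk}$ by contraction: $\prod y_{ij}^{\alpha_{ij}}\circ\prod x_{ij}^{\beta_{ij}}=\prod x_{ij}^{\beta_{ij}-\alpha_{ij}}$ (products over $i<j$) if $\alpha_{ij}\le\beta_{ij}$ for all $i<j$, and $0$ otherwise, extended $\mathsf k$-bilinearly. $\mathrm{Ann}(F)=\{\Phi\in S^{sk}:\Phi\circ F=0\}$. The Pfaffian is $Pf(X^{sk})=\sum_{\sigma\in F_{2n}}\mathrm{sgn}(\sigma)\,x_{\sigma(1)\sigma(2)}\cdots x_{\sigma(2n-1)\sigma(2n)}$, where $F_{2n}$ is the set of permutations $\sigma$ of $\{1,\dots,2n\}$ with $\sigma(1)<\sigma(3)<\dots<\sigma(2n-1)$ and $\sigma(2i-1)<\sigma(2i)$ for $1\le i\le n$. $S^{sk}$ is the homogeneous coordinate ring of the projective space $\mathbf P(R^{sk}_1)$ of 1-dimensional subspaces of $R^{sk}_1$; for a zero-dimensional closed subscheme $\Gamma\subset\mathbf P(R^{sk}_1)$, $I_\Gamma\subset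 S^{sk}$ is its (saturated) homogeneous ideal and $\deg\Gamma$ its length. The cactus rank is $cr(F)=\min\{\deg\Gamma:\Gamma\subset\mathbf P(R^{sk}_1),\ \dim\Gamma=0,\ I_\Gamma\subset\mathrm{Ann}(F)\}$. *)

theory Defs
  imports
    "HOL-Library.Poly_Mapping"
    "HOL-Library.Product_Lexorder"
    "HOL-Library.Extended_Nat"
    "HOL-Computational_Algebra.Fraction_Field"
    "HOL-Combinatorics.Permutations"
    "HOL-Algebra.Algebraic_Closure_Type"
begin

text \<open>
  Multivariate polynomials over a field are finitely supported functions from exponent vectors
  to coefficients, with the convolution product of \<^theory>\<open>HOL-Library.Poly_Mapping\<close>.
  The ambient type has a variable for every element of \<^typ>\<open>'v\<close>; the polynomial
  ring in the variables \<open>V\<close> is a subring of it.  The linear order on \<^typ>\<open>'v\<close> plays no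
  mathematical role: the library needs it to know that there are no zero divisors.
\<close>

type_synonym ('v, 'k) mpoly = "('v \<Rightarrow>\<^sub>0 nat) \<Rightarrow>\<^sub>0 'k"

definition polys :: "'v set \<Rightarrow> ('v, 'k::field) mpoly set" where
  "polys V = {f. \<forall>m\<in>Poly_Mapping.keys f. Poly_Mapping.keys m \<subseteq> V}"

definition poly_ring :: "'v set \<Rightarrow> ('v, 'k::field) mpoly ring" where
  "poly_ring V = ring_of_type_algebra\<lparr>carrier := polys V\<rparr>"

definition var :: "'v \<Rightarrow> ('v, 'k::field) mpoly" where
  "var v = Poly_Mapping.single (Poly_Mapping.single v 1) 1"

definition mdeg :: "('v \<Rightarrow>\<^sub>0 nat) \<Rightarrow> nat" where
  "mdeg m = (\<Sum>v\<in>Poly_Mapping.keys m. Poly_Mapping.lookup m v)"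

definition homogeneous :: "nat \<Rightarrow> ('v, 'k::field) mpoly \<Rightarrow> bool" where
  "homogeneous d f \<longleftrightarrow> (\<forall>m\<in>Poly_Mapping.keys f. mdeg m = d)"

definition hom_component :: "nat \<Rightarrow> ('v, 'k::field) mpoly \<Rightarrow> ('v, 'k) mpoly" where
  "hom_component d f = (\<Sum>m\<in>{m \<in> Poly_Mapping.keys f. mdeg m = d}. Poly_Mapping.single m (Poly_Mapping.lookup f m))"

definition homogeneous_ideal :: "'v set \<Rightarrow> ('v, 'k::field) mpoly set \<Rightarrow> bool" where
  "homogeneous_ideal V I \<longleftrightarrow>
     ideal I (poly_ring V) \<and> (\<forall>f\<in>I. \<forall>d. hom_component d f \<in> I)"

definition irrelevant_ideal :: "'v set \<Rightarrow> ('v, 'k::field) mpoly set" where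
  "irrelevant_ideal V = {f \<in> polys V. Poly_Mapping.lookup f 0 = 0}"

text \<open>
  Saturation with respect to the irrelevant ideal \<open>\<mm>\<close>: the powers of \<open>\<mm>\<close> are generated by the
  forms of a fixed degree, so \<open>\<mm>\<^sup>N f \<subseteq> I\<close> says that all forms of degree \<open>N\<close> multiply \<open>f\<close> into \<open>I\<close>.
\<close>

definition saturated :: "'v set \<Rightarrow> ('v, 'k::field) mpoly set \<Rightarrow> bool" where
  "saturated V I \<longleftrightarrow>
     (\<forall>f\<in>polys V. (\<exists>N. \<forall>g\<in>polys V. homogeneous N g \<longrightarrow> g * f \<in> I) \<longrightarrow> f \<in> I)"


text \<open>
  A closed subscheme \<open>\<Gamma>\<close> of the projective space with homogeneous coordinate ring
  \<^term>\<open>polys V\<close> is represented by its saturated homogeneous ideal \<open>I\<close>, that is,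
  \<open>\<Gamma> = Proj (S/I)\<close>.  Its points are the homogeneous primes over \<open>I\<close> that do
  not contain the irrelevant ideal.
\<close>

definition closed_subscheme :: "'v set \<Rightarrow> ('v, 'k::field) mpoly set \<Rightarrow> bool" where
  "closed_subscheme V I \<longleftrightarrow> homogeneous_ideal V I \<and> saturated V I"

definition points :: "'v set \<Rightarrow> ('v, 'k::field) mpoly set \<Rightarrow> ('v, 'k) mpoly set set" where
  "points V I = {P. homogeneous_ideal V P \<and> primeideal P (poly_ring V) \<and>
                    I \<subseteq> P \<and> \<not> irrelevant_ideal V \<subseteq> P}"

text \<open>
  Krull dimension \<open>0\<close>: the irreducible closed subsets of \<open>\<Gamma>\<close> are the closures of its points, so
  the longest chain of them has length \<open>0\<close> iff \<open>\<Gamma>\<close> is nonempty and no point strictly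
  specialises to another one.
\<close>

definition zero_dimensional :: "'v set \<Rightarrow> ('v, 'k::field) mpoly set \<Rightarrow> bool" where
  "zero_dimensional V I \<longleftrightarrow>
     points V I \<noteq> {} \<and> (\<nexists>P Q. P \<in> points V I \<and> Q \<in> points V I \<and> P \<subset> Q)"

text \<open>
  The local ring of projective space at a point \<open>P\<close> is the homogeneous localisation
  \<open>S\<^bsub>(P)\<^esub>\<close>, inside the fraction field of the polynomial ring; the stalk of the ideal sheaf
  of \<open>\<Gamma>\<close> is \<open>I\<^bsub>(P)\<^esub>\<close>, and the local ring of \<open>\<Gamma>\<close> at \<open>P\<close> is the quotient
  \<open>S\<^bsub>(P)\<^esub> / I\<^bsub>(P)\<^esub>\<close>.
\<close>

definition local_ring ::
  "'v::linorder set \<Rightarrow> ('v, 'k::field) mpoly set \<Rightarrow> ('v, 'k) mpoly fract set" where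
  "local_ring V P = {Fract f g | f g. f \<in> polys V \<and> g \<in> polys V - P \<and>
                       (\<exists>d. homogeneous d f \<and> homogeneous d g)}"

definition ideal_stalk ::
  "'v::linorder set \<Rightarrow> ('v, 'k::field) mpoly set \<Rightarrow> ('v, 'k) mpoly set \<Rightarrow>
     ('v, 'k) mpoly fract set" where
  "ideal_stalk V I P = {Fract f g | f g. f \<in> I \<and> g \<in> polys V - P \<and>
                          (\<exists>d. homogeneous d f \<and> homogeneous d g)}"

definition scalar :: "'k::field \<Rightarrow> ('v::linorder, 'k) mpoly fract" where
  "scalar c = Fract (Poly_Mapping.single 0 c) 1"

definition independent_mod ::
  "('v::linorder, 'k::field) mpoly fract set \<Rightarrow> ('v, 'k) mpoly fract set \<Rightarrow> bool" where
  "independent_mod W B \<longleftrightarrow>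
     (\<forall>c :: _ \<Rightarrow> 'k. (\<Sum>b\<in>B. scalar (c b) * b) \<in> W \<longrightarrow> (\<forall>b\<in>B. c b = 0))"

text \<open>The dimension over \<^typ>\<open>'k\<close> of the quotient of a space \<open>U\<close> by a subspace \<open>W\<close>.\<close>

definition quotient_dim ::
  "('v::linorder, 'k::field) mpoly fract set \<Rightarrow> ('v, 'k) mpoly fract set \<Rightarrow> enat" where
  "quotient_dim U W = (SUP B\<in>{B. finite B \<and> B \<subseteq> U \<and> independent_mod W B}. enat (card B))"

text \<open>
  The length of a zero-dimensional \<open>\<Gamma>\<close> is the dimension of its space of global sections, which is
  the product of the (finitely many) local rings.  The supremum over finite sets of points gives
  this sum as an extended natural number without a separate proof of finiteness.
\<close>

definition scheme_length :: "'v::linorder set \<Rightarrow> ('v, 'k::field) mpoly set \<Rightarrow> enat" where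
  "scheme_length V I =
     (SUP A\<in>{A. finite A \<and> A \<subseteq> points V I}.
        \<Sum>P\<in>A. quotient_dim (local_ring V P) (ideal_stalk V I P))"


text \<open>
  The polynomial ring acting by contraction and the one acted upon are two copies of the same
  ring, and the variables indexed by \<open>v\<close> in them (\<open>y\<^sub>v\<close> and \<open>x\<^sub>v\<close>) are both \<^term>\<open>var v\<close>.
  Divisibility of monomials is spelled out, as \<open>\<le>\<close> on exponent vectors is a
  lexicographic order in the library.
\<close>

definition contract_monom :: "('v \<Rightarrow>\<^sub>0 nat) \<Rightarrow> ('v \<Rightarrow>\<^sub>0 nat) \<Rightarrow> ('v, 'k::field) mpoly" where
  "contract_monom a b =
     (if \<forall>v. Poly_Mapping.lookup a v \<le> Poly_Mapping.lookup b v then Poly_Mapping.single (b - a) 1 else 0)"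

definition contract :: "('v, 'k::field) mpoly \<Rightarrow> ('v, 'k) mpoly \<Rightarrow> ('v, 'k) mpoly"
  (infixr \<open>\<circ>\<^sub>c\<close> 70) where
  "\<Phi> \<circ>\<^sub>c F = (\<Sum>a\<in>Poly_Mapping.keys \<Phi>. \<Sum>b\<in>Poly_Mapping.keys F.
               Poly_Mapping.single 0 (Poly_Mapping.lookup \<Phi> a * Poly_Mapping.lookup F b) * contract_monom a b)"

definition Ann :: "'v set \<Rightarrow> ('v, 'k::field) mpoly \<Rightarrow> ('v, 'k) mpoly set" where
  "Ann V F = {\<Phi> \<in> polys V. \<Phi> \<circ>\<^sub>c F = 0}"

text \<open>Infima of nonempty sets of extended naturals are attained, so this is a minimum.\<close>

definition cactus_rank :: "'v::linorder set \<Rightarrow> ('v, 'k::field) mpoly \<Rightarrow> enat" where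
  "cactus_rank V F =
     (INF I\<in>{I. closed_subscheme V I \<and> zero_dimensional V I \<and> I \<subseteq> Ann V F}. scheme_length V I)"


definition skew_vars :: "nat \<Rightarrow> (nat \<times> nat) set" where
  "skew_vars m = {(i, j). 1 \<le> i \<and> i < j \<and> j \<le> m}"

definition generic_skew :: "nat \<Rightarrow> nat \<Rightarrow> (nat \<times> nat, 'k::field) mpoly" where
  "generic_skew i j = (if i < j then var (i, j) else if j < i then - var (j, i) else 0)"

definition pfaffian_perms :: "nat \<Rightarrow> (nat \<Rightarrow> nat) set" where
  "pfaffian_perms n = {\<sigma>. \<sigma> permutes {1..2*n} \<and>
     (\<forall>i\<in>{1..<n}. \<sigma> (2*i - 1) < \<sigma> (2*i + 1)) \<and>
     (\<forall>i\<in>{1..n}. \<sigma> (2*i - 1) < \<sigma> (2*i))}"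

text \<open>The Pfaffian of the \<open>2n \<times> 2n\<close> matrix with entries \<open>A i j\<close>, where \<open>1 \<le> i, j \<le> 2n\<close>.\<close>

definition pfaffian :: "nat \<Rightarrow> (nat \<Rightarrow> nat \<Rightarrow> 'a::comm_ring_1) \<Rightarrow> 'a" where
  "pfaffian n A = (\<Sum>\<sigma>\<in>pfaffian_perms n. of_int (sign \<sigma>) * (\<Prod>i=1..n. A (\<sigma> (2*i - 1)) (\<sigma> (2*i))))"

end

theory Submission
  imports Defs
begin

text \<open>
  Both bounds rest on the fact that \<open>S/Ann(Pf)\<close> has dimension \<open>2^(2n-1)\<close>: contracting the
  Pfaffian by the monomial of a perfect matching of an even subset \<open>T\<close> of the indices gives, up to
  sign, the Pfaffian of the complementary submatrix, whichever matching of \<open>T\<close> is used, and all other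
  monomials contract it to \<open>0\<close>.

  Upper bound: the scheme supported at the single point \<open>[x\<^sub>1\<^sub>2]\<close> that is apolar to the
  dehomogenisation of the Pfaffian at \<open>x\<^sub>1\<^sub>2 = 1\<close>; its ideal is the intersection of the annihilators of
  all \<open>x\<^sub>1\<^sub>2\<^sup>M Pf\<close>.

  Lower bound (Ranestad--Schreyer): if \<open>I\<close> is saturated, then \<open>dim (S/I)\<^sub>s\<close> is at most the length of the
  scheme, so it is enough that \<open>dim (S/I)\<^sub>s + dim (S/Ann(Pf))\<^sub>s\<^sub>+\<^sub>2 \<le> dim (S/I)\<^sub>s\<^sub>+\<^sub>2\<close>.  Over an infinite
  field one would multiply by a quadric of \<open>Ann(Pf)\<close> that avoids the points of the scheme.  Such a
  quadric may fail to exist over a finite field; instead the multiplications by the squares of the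
  variables, all of which lie in \<open>Ann(Pf)\<close>, are applied to the successive quotients of a filtration.
\<close>

section \<open>Linear algebra\<close>

context vector_space
begin

lemma complement_basis:
  assumes "subspace U'" "U' \<subseteq> U" "finite A" "U \<subseteq> span A"
  obtains Z where "finite Z" "Z \<subseteq> U" "dim U = dim U' + card Z"
    "\<And>c. (\<Sum>z\<in>Z. c z *s z) \<in> U' \<Longrightarrow> \<forall>z\<in>Z. c z = 0"
proof -
  obtain B' where B': "B' \<subseteq> U'" "independent B'" "U' \<subseteq> span B'" "card B' = dim U'"
    using basis_exists by blast
  obtain B where B: "B' \<subseteq> B" "B \<subseteq> U" "independent B" "U \<subseteq> span B"
    using maximal_independent_subset_extend[of B' U] B' assms(2) by (metis order_trans)
  have finB: "finite B"
    using independent_span_bound[OF assms(3) B(3)] B(2) assms(4) by blast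
  then have finB': "finite B'"
    using B(1) finite_subset by blast
  have "dim U = dim U' + card (B - B')"
    using basis_card_eq_dim[OF B(2,4,3)] B'(4) card_Diff_subset[OF finB' B(1)] card_mono[OF finB B(1)]
    by simp
  moreover have "\<forall>z\<in>B - B'. c z = 0" if "(\<Sum>z\<in>B - B'. c z *s z) \<in> U'" for c
  proof -
    have "(\<Sum>z\<in>B - B'. c z *s z) \<in> span B'"
      using that B'(3) by blast
    then obtain d where d: "(\<Sum>z\<in>B - B'. c z *s z) = (\<Sum>b\<in>B'. d b *s b)"
      unfolding span_finite[OF finB'] by auto
    define e where "e b = (if b \<in> B' then - d b else c b)" for b
    have "(\<Sum>b\<in>B. e b *s b) = (\<Sum>b\<in>B - B'. e b *s b) + (\<Sum>b\<in>B'. e b *s b)"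
      by (rule sum.subset_diff[OF B(1) finB])
    also have "(\<Sum>b\<in>B - B'. e b *s b) = (\<Sum>z\<in>B - B'. c z *s z)"
      by (intro sum.cong) (auto simp: e_def)
    also have "(\<Sum>b\<in>B'. e b *s b) = - (\<Sum>b\<in>B'. d b *s b)"
      unfolding sum_negf[symmetric] by (intro sum.cong) (auto simp: e_def)
    finally have "(\<Sum>b\<in>B. e b *s b) = 0"
      using d by simp
    then have "e b = 0" if "b \<in> B" for b
      using independentD[OF B(3) finB subset_refl] that by blast
    then show ?thesis
      by (metis DiffD1 DiffD2 e_def)
  qed
  ultimately show thesis
    using that[of "B - B'"] finB B(2) by blast
qed

lemma span_image_sum:
  assumes "finite Z" "a \<in> span (h ` Z)"
  shows "\<exists>c. a = (\<Sum>z\<in>Z. c z *s h z)"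
  using assms
proof (induction Z arbitrary: a rule: finite_induct)
  case empty
  then show ?case by simp
next
  case (insert x Z)
  from insert.prems obtain k where "a - k *s h x \<in> span (h ` Z)"
    unfolding image_insert span_breakdown_eq by blast
  then obtain c where c: "a - k *s h x = (\<Sum>z\<in>Z. c z *s h z)"
    using insert.IH by blast
  have "a = (\<Sum>z\<in>insert x Z. (c(x := k)) z *s h z)"
  proof -
    have "(\<Sum>z\<in>insert x Z. (c(x := k)) z *s h z) = k *s h x + (\<Sum>z\<in>Z. (c(x := k)) z *s h z)"
      using insert.hyps by simp
    also have "(\<Sum>z\<in>Z. (c(x := k)) z *s h z) = (\<Sum>z\<in>Z. c z *s h z)"
      using insert.hyps by (intro sum.cong) auto
    finally show ?thesis
      using c by (simp add: algebra_simps)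
  qed
  then show ?case by blast
qed

lemma card_add_dim_le_dim:
  assumes W: "subspace W" "W \<subseteq> U" and U: "finite A" "U \<subseteq> span A"
    and B: "finite B" "h ` B \<subseteq> U"
    and ind: "\<And>c. (\<Sum>b\<in>B. c b *s h b) \<in> W \<Longrightarrow> \<forall>b\<in>B. c b = 0"
  shows "card B + dim W \<le> dim U"
proof -
  obtain C where C: "C \<subseteq> W" "independent C" "W \<subseteq> span C" "card C = dim W"
    using basis_exists by blast
  have finC: "finite C"
    using independent_span_bound[OF U(1) C(2)] C(1) W(2) U(2) by blast
  have step: "Z \<subseteq> B \<longrightarrow> independent (h ` Z \<union> C) \<and> card (h ` Z \<union> C) = card Z + card C"
    if "finite Z" for Z
    using that
  proof (induction Z rule: finite_induct)
    case empty
    then show ?case using C by simp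
  next
    case (insert z Z)
    show ?case
    proof
      assume sub: "insert z Z \<subseteq> B"
      have "h z \<notin> span (h ` Z \<union> C)"
      proof
        assume "h z \<in> span (h ` Z \<union> C)"
        then obtain a w where aw: "h z = a + w" "a \<in> span (h ` Z)" "w \<in> span C"
          unfolding span_Un by blast
        obtain c where c: "a = (\<Sum>z\<in>Z. c z *s h z)"
          using span_image_sum[OF insert.hyps(1) aw(2)] by blast
        define e where "e b = (if b = z then 1 else if b \<in> Z then - c b else 0)" for b
        have "(\<Sum>b\<in>B. e b *s h b) = (\<Sum>b\<in>insert z Z. e b *s h b)"
          using sub B(1) by (intro sum.mono_neutral_right) (simp_all add: e_def)
        also have "\<dots> = h z + (\<Sum>b\<in>Z. e b *s h b)"
          using insert.hyps by (simp add: e_def)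
        also have "(\<Sum>b\<in>Z. e b *s h b) = - a"
          unfolding c sum_negf[symmetric] using insert.hyps
          by (intro sum.cong) (simp_all add: e_def, metis)
        also have "h z + - a = w"
          using aw(1) by simp
        finally have "(\<Sum>b\<in>B. e b *s h b) \<in> W"
          using aw(3) span_minimal[OF C(1) W(1)] by auto
        then have "e z = 0"
          using ind sub by blast
        then show False
          by (simp add: e_def)
      qed
      moreover from this have "h z \<notin> h ` Z \<union> C"
        by (metis span_base)
      moreover have "independent (h ` Z \<union> C)" "card (h ` Z \<union> C) = card Z + card C"
        using insert.IH sub by simp_all
      ultimately show "independent (h ` insert z Z \<union> C) \<and> card (h ` insert z Z \<union> C) = card (insert z Z) + card C"
        using insert.hyps finC by (simp add: independent_insertI)
    qed
  qed
  have D: "independent (h ` B \<union> C)" "card (h ` B \<union> C) = card B + card C"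
    using step[OF B(1)] by simp_all
  obtain E where E: "E \<subseteq> U" "independent E" "U \<subseteq> span E" "card E = dim U"
    using basis_exists by blast
  have "finite E"
    using independent_span_bound[OF U(1) E(2)] E(1) U(2) by blast
  moreover have "h ` B \<union> C \<subseteq> span E"
    using B(2) C(1) W(2) E(3) by blast
  ultimately have "card (h ` B \<union> C) \<le> card E"
    using independent_span_bound D(1) by blast
  then show ?thesis
    using D(2) C(4) E(4) by simp
qed

lemma dim_add_dim_le:
  assumes T: "Vector_Spaces.linear scale scale T" "T ` U \<subseteq> Y" "\<And>x. x \<in> U \<Longrightarrow> T x \<in> Y' \<Longrightarrow> x \<in> U'"
    and U: "subspace U'" "U' \<subseteq> U" "subspace U" "finite A" "U \<subseteq> span A"
    and Y: "subspace Y'" "Y' \<subseteq> Y" "finite C" "Y \<subseteq> span C"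
  shows "dim U + dim Y' \<le> dim U' + dim Y"
proof -
  interpret T: Vector_Spaces.linear scale scale T by (rule T(1))
  obtain Z where Z: "finite Z" "Z \<subseteq> U" "dim U = dim U' + card Z"
    "\<And>c. (\<Sum>z\<in>Z. c z *s z) \<in> U' \<Longrightarrow> \<forall>z\<in>Z. c z = 0"
    using complement_basis[OF U(1,2,4,5)] by blast
  have "card Z + dim Y' \<le> dim Y"
  proof (rule card_add_dim_le_dim[where h = T, OF Y Z(1)])
    show "T ` Z \<subseteq> Y"
      using T(2) Z(2) by blast
    fix c assume "(\<Sum>z\<in>Z. c z *s T z) \<in> Y'"
    then have "T (\<Sum>z\<in>Z. c z *s z) \<in> Y'"
      by (simp add: T.sum T.scale)
    moreover have "(\<Sum>z\<in>Z. c z *s z) \<in> U"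
      using Z(2) U(3) by (intro subspace_sum subspace_scale) auto
    ultimately show "\<forall>z\<in>Z. c z = 0"
      using T(3) Z(4) by blast
  qed
  then show ?thesis
    using Z(3) by simp
qed

end

section \<open>Polynomials, ideals and contraction\<close>

abbreviation "lookup \<equiv> Poly_Mapping.lookup"
abbreviation "keys \<equiv> Poly_Mapping.keys"
abbreviation "single \<equiv> Poly_Mapping.single"

lemma poly_mapping_sum_single: "f = (\<Sum>m\<in>keys f. single m (lookup f m))"
proof (rule poly_mapping_eqI)
  fix k
  have "lookup (\<Sum>m\<in>keys f. single m (lookup f m)) k = (\<Sum>m\<in>keys f. if m = k then lookup f k else 0)"
    unfolding lookup_sum by (intro sum.cong) (auto simp: lookup_single when_def)
  also have "\<dots> = lookup f k"
    by (auto simp: in_keys_iff)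
  finally show "lookup f k = lookup (\<Sum>m\<in>keys f. single m (lookup f m)) k" ..
qed

lemma lookup_single_mult:
  fixes f :: "'a::monoid_add \<Rightarrow>\<^sub>0 'b::semiring_0"
  shows "lookup (single a c * f) q = (\<Sum>k\<in>keys f. if a + k = q then c * lookup f k else 0)"
proof -
  have "single a c * f = (\<Sum>k\<in>keys f. single a c * single k (lookup f k))"
    by (subst (1) poly_mapping_sum_single[of f]) (simp add: sum_distrib_left)
  then show ?thesis
    by (simp add: lookup_sum mult_single lookup_single when_def)
qed

lemma lookup_single_mult_add:
  fixes f :: "'a::cancel_comm_monoid_add \<Rightarrow>\<^sub>0 'b::semiring_0"
  shows "lookup (single a c * f) (a + m) = c * lookup f m"
  unfolding lookup_single_mult by (auto simp: in_keys_iff)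

lemma lookup_scale:
  fixes f :: "'a::cancel_comm_monoid_add \<Rightarrow>\<^sub>0 'b::semiring_0"
  shows "lookup (single 0 c * f) m = c * lookup f m"
  using lookup_single_mult_add[of 0 c f m] by simp

lemma lookup_single_mult_eq_0:
  fixes f :: "'a::monoid_add \<Rightarrow>\<^sub>0 'b::semiring_0"
  assumes "\<And>k. k \<in> keys f \<Longrightarrow> q \<noteq> a + k"
  shows "lookup (single a c * f) q = 0"
  unfolding lookup_single_mult using assms by (intro sum.neutral) auto

lemma lookup_mult_sum:
  fixes f g :: "'a::monoid_add \<Rightarrow>\<^sub>0 'b::semiring_0"
  shows "lookup (f * g) q =
    (\<Sum>a\<in>keys f. \<Sum>b\<in>keys g. if a + b = q then lookup f a * lookup g b else 0)"
proof -
  have "f * g = (\<Sum>a\<in>keys f. single a (lookup f a) * g)"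
    by (subst (1) poly_mapping_sum_single[of f]) (simp add: sum_distrib_right)
  then show ?thesis
    by (simp add: lookup_sum lookup_single_mult)
qed

interpretation mpoly: vector_space "\<lambda>c f. single 0 c * f :: ('v, 'k::field) mpoly"
  by unfold_locales
    (simp_all add: algebra_simps single_add mult_single flip: mult.assoc)

lemma linear_mult_mpoly:
  "Vector_Spaces.linear (\<lambda>c f. single 0 c * f) (\<lambda>c f. single 0 c * f)
     (\<lambda>f. g * f :: ('v, 'k::field) mpoly)"
  by unfold_locales (simp_all add: algebra_simps)

lemma mdeg_altdef:
  assumes "finite A" "keys m \<subseteq> A"
  shows "mdeg m = (\<Sum>v\<in>A. lookup m v)"
  unfolding mdeg_def using assms by (intro sum.mono_neutral_left) (auto simp: in_keys_iff)

lemma mdeg_add: "mdeg (a + b) = mdeg a + mdeg b"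
proof -
  have "keys (a + b) \<subseteq> keys a \<union> keys b"
    by (rule keys_add)
  then show ?thesis
    using mdeg_altdef[of "keys a \<union> keys b" a] mdeg_altdef[of "keys a \<union> keys b" b]
      mdeg_altdef[of "keys a \<union> keys b" "a + b"]
    by (simp add: lookup_add sum.distrib)
qed

lemma mdeg_0 [simp]: "mdeg 0 = 0"
  by (simp add: mdeg_def)

lemma mdeg_single [simp]: "mdeg (single v n) = n"
  by (simp add: mdeg_def)

lemma keys_add_nat: "keys (a + b :: 'v \<Rightarrow>\<^sub>0 nat) = keys a \<union> keys b"
  by (auto simp: in_keys_iff lookup_add)

lemma monomial_split:
  assumes "\<And>v. lookup a v \<le> lookup b v"
  shows "b = a + (b - a :: 'v \<Rightarrow>\<^sub>0 nat)"
  by (rule poly_mapping_eqI) (use assms in \<open>simp add: lookup_add lookup_minus\<close>)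

lemma single_eq_0_iff [simp]: "single a c = 0 \<longleftrightarrow> c = 0"
  by (metis lookup_single_eq lookup_zero single_zero)

lemma zero_in_polys [simp]: "0 \<in> polys V"
  by (simp add: polys_def)

lemma one_in_polys [simp]: "1 \<in> polys V"
  by (auto simp: polys_def simp flip: single_one)

lemma add_in_polys: "f \<in> polys V \<Longrightarrow> g \<in> polys V \<Longrightarrow> f + g \<in> polys V"
  using keys_add[of f g] by (auto simp: polys_def)

lemma single_in_polys: "keys m \<subseteq> V \<Longrightarrow> single m c \<in> polys V"
  by (auto simp: polys_def)

lemma const_in_polys [simp]: "single 0 c \<in> polys V"
  by (simp add: single_in_polys)

lemma mult_in_polys: "f \<in> polys V \<Longrightarrow> g \<in> polys V \<Longrightarrow> f * g \<in> polys V"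
  using keys_mult[of f g] by (fastforce simp: polys_def keys_add_nat)

lemma uminus_in_polys: "f \<in> polys V \<Longrightarrow> - f \<in> polys V"
  by (simp add: polys_def)

lemma sum_in_polys: "(\<And>i. i \<in> A \<Longrightarrow> f i \<in> polys V) \<Longrightarrow> sum f A \<in> polys V"
  by (induction A rule: infinite_finite_induct) (auto intro: add_in_polys)

lemma var_in_polys: "v \<in> V \<Longrightarrow> var v \<in> polys V"
  unfolding var_def by (intro single_in_polys) simp

lemma power_in_polys: "f \<in> polys V \<Longrightarrow> f ^ n \<in> polys V"
  by (induction n) (auto intro: mult_in_polys)

lemma var_power: "var v ^ n = single (single v n) 1"
  by (induction n) (simp_all add: var_def mult_single flip: single_add)

lemma homogeneous_0 [simp]: "homogeneous d 0"
  by (simp add: homogeneous_def)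

lemma homogeneous_add: "homogeneous d f \<Longrightarrow> homogeneous d g \<Longrightarrow> homogeneous d (f + g)"
  using keys_add[of f g] by (auto simp: homogeneous_def)

lemma homogeneous_mult: "homogeneous d f \<Longrightarrow> homogeneous e g \<Longrightarrow> homogeneous (d + e) (f * g)"
  using keys_mult[of f g] by (fastforce simp: homogeneous_def mdeg_add)

lemma homogeneous_single: "mdeg m = d \<Longrightarrow> homogeneous d (single m c)"
  by (auto simp: homogeneous_def)

lemma homogeneous_scale: "homogeneous d f \<Longrightarrow> homogeneous d (single 0 c * f)"
  using homogeneous_mult[OF homogeneous_single[of 0 0 c], of d f] by simp

lemma homogeneous_var_power: "homogeneous n (var v ^ n)"
  unfolding var_power by (rule homogeneous_single) simp

lemma lookup_hom_component: "lookup (hom_component d f) m = (if mdeg m = d then lookup f m else 0)"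
proof -
  have "lookup (hom_component d f) m =
      (\<Sum>k\<in>{k \<in> keys f. mdeg k = d}. if k = m then lookup f m else 0)"
    unfolding hom_component_def lookup_sum by (intro sum.cong) (auto simp: lookup_single when_def)
  also have "\<dots> = (if mdeg m = d then lookup f m else 0)"
    by (auto simp: in_keys_iff)
  finally show ?thesis .
qed

lemma hom_component_add: "hom_component d (f + g) = hom_component d f + hom_component d g"
  by (rule poly_mapping_eqI) (simp add: lookup_hom_component lookup_add)

lemma hom_component_0 [simp]: "hom_component d 0 = 0"
  by (rule poly_mapping_eqI) (simp add: lookup_hom_component)

lemma hom_component_sum: "hom_component d (sum f A) = (\<Sum>i\<in>A. hom_component d (f i))"
  by (induction A rule: infinite_finite_induct) (simp_all add: hom_component_add)

lemma keys_hom_component: "keys (hom_component d f) = {m \<in> keys f. mdeg m = d}"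
  by (auto simp: in_keys_iff lookup_hom_component split: if_splits)

lemma homogeneous_hom_component [simp]: "homogeneous d (hom_component d f)"
  by (simp add: homogeneous_def keys_hom_component)

lemma hom_component_in_polys: "f \<in> polys V \<Longrightarrow> hom_component d f \<in> polys V"
  by (auto simp: polys_def keys_hom_component)

lemma hom_component_homogeneous:
  assumes "homogeneous e f"
  shows "hom_component d f = (if d = e then f else 0)"
proof (rule poly_mapping_eqI)
  fix m
  have "lookup f m = 0" if "mdeg m \<noteq> e"
    using assms that by (auto simp: homogeneous_def in_keys_iff)
  then show "lookup (hom_component d f) m = lookup (if d = e then f else 0) m"
    by (auto simp: lookup_hom_component)
qed

lemma finite_hom_components: "finite {d. hom_component d f \<noteq> 0}"
proof (rule finite_subset)
  show "{d. hom_component d f \<noteq> 0} \<subseteq> mdeg ` keys f"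
    by (auto simp: hom_component_def intro: rev_image_eqI)
      (metis (mono_tags, lifting) empty_Collect_eq image_eqI sum.empty)
qed simp

lemma sum_hom_components:
  assumes "finite D" "\<And>d. hom_component d f \<noteq> 0 \<Longrightarrow> d \<in> D"
  shows "f = (\<Sum>d\<in>D. hom_component d f)"
proof (rule poly_mapping_eqI)
  fix m
  have "mdeg m \<notin> D \<Longrightarrow> lookup f m = 0"
    using assms(2)[of "mdeg m"] lookup_hom_component[of "mdeg m" f m] by (metis lookup_zero)
  then show "lookup f m = lookup (\<Sum>d\<in>D. hom_component d f) m"
    using assms(1) by (auto simp: lookup_sum lookup_hom_component)
qed

lemma hom_component_mult_homogeneous:
  assumes "homogeneous e g"
  shows "hom_component (d + e) (f * g) = hom_component d f * g"
proof -
  let ?D = "insert d {d. hom_component d f \<noteq> 0}"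
  have fin: "finite ?D"
    using finite_hom_components[of f] by simp
  have "f * g = (\<Sum>i\<in>?D. hom_component i f * g)"
    by (subst sum_hom_components[OF fin]) (auto simp: sum_distrib_right)
  then have "hom_component (d + e) (f * g) = (\<Sum>i\<in>?D. hom_component (d + e) (hom_component i f * g))"
    by (simp only: hom_component_sum)
  also have "\<dots> = (\<Sum>i\<in>?D. if i = d then hom_component d f * g else 0)"
    by (intro sum.cong refl)
      (auto simp: hom_component_homogeneous[OF homogeneous_mult[OF homogeneous_hom_component assms]])
  also have "\<dots> = hom_component d f * g"
    using fin by simp
  finally show ?thesis .
qed

lemma hom_component_mult_homogeneous_less:
  assumes "homogeneous e g" "d < e"
  shows "hom_component d (f * g) = 0"
proof (rule poly_mapping_eqI)
  fix m
  have "lookup (f * g) m = 0" if "mdeg m = d"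
  proof (rule ccontr)
    assume "lookup (f * g) m \<noteq> 0"
    then obtain a b where "m = a + b" "b \<in> keys g"
      using keys_mult[of f g] by (auto simp: in_keys_iff)
    then show False
      using assms that by (auto simp: homogeneous_def mdeg_add)
  qed
  then show "lookup (hom_component d (f * g)) m = lookup 0 m"
    by (simp add: lookup_hom_component)
qed

definition forms :: "'v set \<Rightarrow> nat \<Rightarrow> ('v, 'k::field) mpoly set" where
  "forms V d = {f \<in> polys V. homogeneous d f}"

definition monomials :: "'v set \<Rightarrow> nat \<Rightarrow> ('v \<Rightarrow>\<^sub>0 nat) set" where
  "monomials V d = {m. keys m \<subseteq> V \<and> mdeg m = d}"

lemma finite_monomials:
  assumes "finite V"
  shows "finite (monomials V d)"
proof -
  have "lookup ` monomials V d \<subseteq> {f. \<forall>x. (x \<in> V \<longrightarrow> f x \<in> {..d}) \<and> (x \<notin> V \<longrightarrow> f x = 0)}"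
  proof clarify
    fix m :: "'a \<Rightarrow>\<^sub>0 nat" and x assume m: "m \<in> monomials V d"
    have "lookup m x \<le> mdeg m" if "x \<in> V"
      using mdeg_altdef[OF assms, of m] m that assms
      by (simp add: monomials_def member_le_sum)
    then show "(x \<in> V \<longrightarrow> lookup m x \<in> {..d}) \<and> (x \<notin> V \<longrightarrow> lookup m x = 0)"
      using m by (auto simp: monomials_def in_keys_iff)
  qed
  then have "finite (lookup ` monomials V d)"
    using finite_subset finite_set_of_finite_funs[OF assms, of "{..d}"] by blast
  moreover have "inj_on lookup (monomials V d)"
    by (auto simp: inj_on_def intro: poly_mapping_eqI)
  ultimately show ?thesis
    using finite_imageD by blast
qed

lemma forms_span: "forms V d \<subseteq> mpoly.span ((\<lambda>m. single m 1) ` monomials V d)"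
proof
  fix f :: "('a, 'b) mpoly" assume f: "f \<in> forms V d"
  have "f = (\<Sum>m\<in>keys f. single 0 (lookup f m) * single m 1)"
    by (subst (1) poly_mapping_sum_single[of f]) (simp add: mult_single)
  also have "\<dots> \<in> mpoly.span ((\<lambda>m. single m 1) ` monomials V d)"
    using f by (intro mpoly.span_sum mpoly.span_scale mpoly.span_base)
      (auto simp: forms_def monomials_def polys_def homogeneous_def)
  finally show "f \<in> mpoly.span ((\<lambda>m. single m 1) ` monomials V d)" .
qed

lemma subspace_forms: "mpoly.subspace (forms V d)"
  by (auto simp: mpoly.subspace_def forms_def
      intro: add_in_polys homogeneous_add mult_in_polys homogeneous_scale)

lemma cring_poly_ring: "cring (poly_ring V :: ('v, 'k::field) mpoly ring)"
proof (rule cringI)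
  show "abelian_group (poly_ring V :: ('v, 'k) mpoly ring)"
  proof (rule abelian_groupI)
    fix f assume f: "f \<in> carrier (poly_ring V :: ('v, 'k) mpoly ring)"
    have "- f + f = 0"
      by simp
    moreover have "- f \<in> polys V"
      using f by (simp add: poly_ring_def uminus_in_polys)
    ultimately show "\<exists>g\<in>carrier (poly_ring V). g \<oplus>\<^bsub>poly_ring V\<^esub> f = \<zero>\<^bsub>poly_ring V\<^esub>"
      by (intro bexI[of _ "- f"]) (simp_all add: poly_ring_def ring_of_type_algebra_def)
  qed (auto simp: poly_ring_def ring_of_type_algebra_def add_in_polys algebra_simps)
  show "comm_monoid (poly_ring V :: ('v, 'k) mpoly ring)"
    by (rule comm_monoidI)
      (auto simp: poly_ring_def ring_of_type_algebra_def mult_in_polys algebra_simps)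
qed (auto simp: poly_ring_def ring_of_type_algebra_def algebra_simps)

lemma ideal_poly_ring_iff:
  "ideal I (poly_ring V) \<longleftrightarrow> I \<subseteq> polys V \<and> 0 \<in> I \<and> (\<forall>f\<in>I. \<forall>g\<in>I. f + g \<in> I) \<and>
     (\<forall>f\<in>polys V. \<forall>g\<in>I. f * g \<in> I)" for I :: "('v, 'k::field) mpoly set"
proof
  assume "ideal I (poly_ring V)"
  then interpret ideal I "poly_ring V" .
  show "I \<subseteq> polys V \<and> 0 \<in> I \<and> (\<forall>f\<in>I. \<forall>g\<in>I. f + g \<in> I) \<and> (\<forall>f\<in>polys V. \<forall>g\<in>I. f * g \<in> I)"
    using a_subset additive_subgroup.zero_closed[OF additive_subgroup_axioms]
      additive_subgroup.a_closed[OF additive_subgroup_axioms] I_l_closed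
    by (auto simp: poly_ring_def ring_of_type_algebra_def)
next
  assume I: "I \<subseteq> polys V \<and> 0 \<in> I \<and> (\<forall>f\<in>I. \<forall>g\<in>I. f + g \<in> I) \<and> (\<forall>f\<in>polys V. \<forall>g\<in>I. f * g \<in> I)"
  then have I': "\<forall>f\<in>I. \<forall>g\<in>polys V. f * g \<in> I"
    by (metis mult.commute)
  interpret cring "poly_ring V :: ('v, 'k) mpoly ring"
    by (rule cring_poly_ring)
  show "ideal I (poly_ring V)"
  proof (rule idealI)
    show "ring (poly_ring V :: ('v, 'k) mpoly ring)"
      by (rule ring_axioms)
    show "subgroup I (add_monoid (poly_ring V))"
    proof
      fix f assume f: "f \<in> I"
      have "\<ominus>\<^bsub>poly_ring V\<^esub> f = single 0 (- 1) * f"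
      proof (rule minus_equality)
        show "single 0 (- 1) * f \<oplus>\<^bsub>poly_ring V\<^esub> f = \<zero>\<^bsub>poly_ring V\<^esub>"
          by (simp add: single_uminus poly_ring_def ring_of_type_algebra_def)
      qed (use f I in \<open>auto simp: poly_ring_def intro: mult_in_polys uminus_in_polys\<close>)
      moreover have "single 0 (- 1) * f \<in> I"
        using f I const_in_polys by blast
      ultimately show "inv\<^bsub>add_monoid (poly_ring V)\<^esub> f \<in> I"
        by (simp add: a_inv_def)
    qed (use I in \<open>auto simp: poly_ring_def ring_of_type_algebra_def\<close>)
  qed (use I I' in \<open>auto simp: poly_ring_def ring_of_type_algebra_def\<close>)
qed

lemma primeideal_poly_ring_iff:
  "primeideal P (poly_ring V) \<longleftrightarrow> ideal P (poly_ring V) \<and> P \<noteq> polys V \<and>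
     (\<forall>f\<in>polys V. \<forall>g\<in>polys V. f * g \<in> P \<longrightarrow> f \<in> P \<or> g \<in> P)" for P :: "('v, 'k::field) mpoly set"
proof
  assume "primeideal P (poly_ring V)"
  then interpret primeideal P "poly_ring V" .
  show "ideal P (poly_ring V) \<and> P \<noteq> polys V \<and>
     (\<forall>f\<in>polys V. \<forall>g\<in>polys V. f * g \<in> P \<longrightarrow> f \<in> P \<or> g \<in> P)"
    using is_ideal I_notcarr I_prime by (auto simp: poly_ring_def ring_of_type_algebra_def)
next
  assume "ideal P (poly_ring V) \<and> P \<noteq> polys V \<and>
     (\<forall>f\<in>polys V. \<forall>g\<in>polys V. f * g \<in> P \<longrightarrow> f \<in> P \<or> g \<in> P)"
  then show "primeideal P (poly_ring V)"
    using cring_poly_ring[of V]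
    by (intro primeidealI) (auto simp: poly_ring_def ring_of_type_algebra_def)
qed

lemma ideal_subset_polys: "ideal I (poly_ring V) \<Longrightarrow> f \<in> I \<Longrightarrow> f \<in> polys V"
  by (auto simp: ideal_poly_ring_iff)

lemma ideal_zero: "ideal I (poly_ring V) \<Longrightarrow> 0 \<in> I"
  by (auto simp: ideal_poly_ring_iff)

lemma ideal_add: "ideal I (poly_ring V) \<Longrightarrow> f \<in> I \<Longrightarrow> g \<in> I \<Longrightarrow> f + g \<in> I"
  by (auto simp: ideal_poly_ring_iff)

lemma ideal_mult: "ideal I (poly_ring V) \<Longrightarrow> f \<in> polys V \<Longrightarrow> g \<in> I \<Longrightarrow> f * g \<in> I"
  by (auto simp: ideal_poly_ring_iff)

lemma ideal_mult2: "ideal I (poly_ring V) \<Longrightarrow> f \<in> I \<Longrightarrow> g \<in> polys V \<Longrightarrow> f * g \<in> I"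
  by (metis ideal_mult mult.commute)

lemma ideal_sum: "ideal I (poly_ring V) \<Longrightarrow> (\<And>i. i \<in> A \<Longrightarrow> f i \<in> I) \<Longrightarrow> sum f A \<in> I"
  by (induction A rule: infinite_finite_induct) (auto intro: ideal_add ideal_zero)

lemma ideal_diff:
  assumes "ideal I (poly_ring V)" "f \<in> I" "g \<in> I"
  shows "f - g \<in> I"
proof -
  have "f + single 0 (- 1) * g \<in> I"
    using assms by (intro ideal_add[OF assms(1)] ideal_mult[OF assms(1)]) auto
  then show ?thesis
    by (simp add: single_uminus)
qed

lemma subspace_ideal: "ideal I (poly_ring V) \<Longrightarrow> mpoly.subspace I"
  by (auto simp: mpoly.subspace_def ideal_zero intro: ideal_add ideal_mult)

lemma ideal_of_monomials:
  assumes "ideal I (poly_ring V)" "\<And>m. m \<in> keys f \<Longrightarrow> single m (lookup f m) \<in> I"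
  shows "f \<in> I"
  by (subst poly_mapping_sum_single) (rule ideal_sum[OF assms])

lemma monomial_eq_mult_var_power:
  assumes "n \<le> lookup m v"
  shows "single m c = single (m - single v n) c * var v ^ n"
proof -
  have "m = single v n + (m - single v n)"
    by (rule monomial_split) (use assms in \<open>auto simp: lookup_single when_def\<close>)
  then show ?thesis
    by (simp add: var_power mult_single add.commute)
qed

lemma keys_diff_subset: "keys (m - k :: 'v \<Rightarrow>\<^sub>0 nat) \<subseteq> keys m"
  by (auto simp: in_keys_iff lookup_minus)

lemma monomial_in_ideal:
  assumes "ideal I (poly_ring V)" "var v ^ n * f \<in> I" "n \<le> lookup m v" "keys m \<subseteq> V"
  shows "single m c * f \<in> I"
proof -
  have "single m c * f = single (m - single v n) c * (var v ^ n * f)"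
    using monomial_eq_mult_var_power[OF assms(3), of c] by (simp add: mult.assoc)
  also have "\<dots> \<in> I"
    using assms(4) keys_diff_subset[of m "single v n"]
    by (intro ideal_mult[OF assms(1) _ assms(2)]) (auto intro: single_in_polys)
  finally show ?thesis .
qed

lemma irrelevant_ideal_subset_iff:
  assumes I: "ideal I (poly_ring V)"
  shows "irrelevant_ideal V \<subseteq> I \<longleftrightarrow> (\<forall>v\<in>V. var v \<in> I)"
proof
  assume "irrelevant_ideal V \<subseteq> I"
  moreover have "var v \<in> irrelevant_ideal V" if "v \<in> V" for v
    using that var_in_polys[OF that] by (auto simp: irrelevant_ideal_def var_def lookup_single when_def)
  ultimately show "\<forall>v\<in>V. var v \<in> I"
    by blast
next
  assume vars: "\<forall>v\<in>V. var v \<in> I"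
  show "irrelevant_ideal V \<subseteq> I"
  proof
    fix f :: "('a, 'b) mpoly" assume f: "f \<in> irrelevant_ideal V"
    show "f \<in> I"
    proof (rule ideal_of_monomials[OF I])
      fix m assume m: "m \<in> keys f"
      then have "m \<noteq> 0" "keys m \<subseteq> V"
        using f by (auto simp: irrelevant_ideal_def in_keys_iff polys_def)
      then obtain v where "v \<in> keys m" "v \<in> V"
        by (metis poly_mapping_eqI in_keys_iff lookup_zero subset_iff ex_in_conv)
      then show "single m (lookup f m) \<in> I"
        using monomial_in_ideal[OF I, of v 1 1 m "lookup f m"] vars \<open>keys m \<subseteq> V\<close>
        by (simp add: in_keys_iff)
    qed
  qed
qed

lemma saturated_powers:
  assumes "finite V" and I: "ideal I (poly_ring V)" "saturated V I" and f: "f \<in> polys V"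
    and powers: "\<And>v. v \<in> V \<Longrightarrow> \<exists>n. var v ^ n * f \<in> I"
  shows "f \<in> I"
proof -
  obtain N where N: "\<And>v. v \<in> V \<Longrightarrow> var v ^ N v * f \<in> I"
    using powers by metis
  have "g * f \<in> I" if g: "g \<in> polys V" "homogeneous (sum N V + 1) g" for g
  proof -
    have "single m (lookup g m) * f \<in> I" if m: "m \<in> keys g" for m
    proof -
      have km: "keys m \<subseteq> V" and "mdeg m = sum N V + 1"
        using g m by (auto simp: polys_def homogeneous_def)
      then have "\<not> (\<forall>v\<in>V. lookup m v \<le> N v)"
        using sum_mono[of V "lookup m" N] mdeg_altdef[OF assms(1) km] by auto
      then show ?thesis
        using monomial_in_ideal[OF I(1) N _ km] by (meson linear)
    qed
    then have "(\<Sum>m\<in>keys g. single m (lookup g m) * f) \<in> I"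
      by (rule ideal_sum[OF I(1)])
    then show ?thesis
      by (simp flip: sum_distrib_right poly_mapping_sum_single)
  qed
  then show ?thesis
    using I(2) f unfolding saturated_def by blast
qed

lemma one_notin_primeideal:
  assumes "primeideal P (poly_ring V)"
  shows "1 \<notin> P"
proof
  have P: "ideal P (poly_ring V)" "P \<noteq> polys V"
    using assms by (auto simp: primeideal_poly_ring_iff)
  assume "1 \<in> P"
  then have "f \<in> P" if "f \<in> polys V" for f
    using ideal_mult[OF P(1) that] by fastforce
  then show False
    using P ideal_subset_polys[OF P(1)] by blast
qed

lemma power_notin_primeideal:
  assumes P: "primeideal P (poly_ring V)" and f: "f \<in> polys V" "f \<notin> P"
  shows "f ^ n \<notin> P"
proof (induction n)
  case 0
  show ?case
    using one_notin_primeideal[OF P] by simp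
next
  case (Suc n)
  then show ?case
    using P f power_in_polys[OF f(1), of n] by (auto simp: primeideal_poly_ring_iff)
qed

lemma primeideal_homogeneousI:
  assumes hom: "homogeneous_ideal V P" and "1 \<notin> P"
    and prime: "\<And>f g d e. f \<in> forms V d \<Longrightarrow> g \<in> forms V e \<Longrightarrow> f * g \<in> P \<Longrightarrow> f \<in> P \<or> g \<in> P"
  shows "primeideal P (poly_ring V)"
proof -
  have P: "ideal P (poly_ring V)"
    using hom by (simp add: homogeneous_ideal_def)
  have top: "\<exists>d. hom_component d f \<notin> P \<and> (\<forall>i>d. hom_component i f \<in> P)" if "f \<in> polys V" "f \<notin> P" for f
  proof -
    let ?D = "{d. hom_component d f \<notin> P}"
    have sub: "?D \<subseteq> {d. hom_component d f \<noteq> 0}"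
      using ideal_zero[OF P] by auto
    then have fin: "finite ?D"
      using finite_hom_components finite_subset by blast
    have "?D \<noteq> {}"
    proof
      assume "?D = {}"
      then have "(\<Sum>d\<in>{d. hom_component d f \<noteq> 0}. hom_component d f) \<in> P"
        by (intro ideal_sum[OF P]) auto
      then show False
        using that(2) sum_hom_components[OF finite_hom_components[of f], of f] by simp
    qed
    then show ?thesis
      using fin Max_in[OF fin] Max_ge[OF fin] by (metis mem_Collect_eq not_le)
  qed
  have "f \<in> P \<or> g \<in> P" if fg: "f \<in> polys V" "g \<in> polys V" "f * g \<in> P" for f g
  proof (rule ccontr)
    assume "\<not> (f \<in> P \<or> g \<in> P)"
    then obtain d e where d: "hom_component d f \<notin> P" "\<And>i. i > d \<Longrightarrow> hom_component i f \<in> P"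
      and e: "hom_component e g \<notin> P" "\<And>i. i > e \<Longrightarrow> hom_component i g \<in> P"
      using top fg by metis
    let ?D = "insert d {d. hom_component d f \<noteq> 0}" and ?E = "insert e {d. hom_component d g \<noteq> 0}"
    have fin: "finite ?D" "finite ?E"
      using finite_hom_components by auto
    define T where "T = (\<lambda>(i, j). hom_component (d + e) (hom_component i f * hom_component j g))"
    have T: "T (i, j) = (if i + j = d + e then hom_component i f * hom_component j g else 0)" for i j
      unfolding T_def by (auto simp: hom_component_homogeneous[OF homogeneous_mult[OF
            homogeneous_hom_component homogeneous_hom_component]])
    have "f * g = (\<Sum>i\<in>?D. hom_component i f) * (\<Sum>j\<in>?E. hom_component j g)"
      using sum_hom_components[OF fin(1), of f] sum_hom_components[OF fin(2), of g] by simp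
    also have "\<dots> = (\<Sum>(i, j)\<in>?D \<times> ?E. hom_component i f * hom_component j g)"
      unfolding sum_product sum.cartesian_product ..
    finally have "hom_component (d + e) (f * g) = (\<Sum>p\<in>?D \<times> ?E. T p)"
      by (simp add: hom_component_sum T_def case_prod_unfold)
    also have "\<dots> = T (d, e) + (\<Sum>p\<in>?D \<times> ?E - {(d, e)}. T p)"
      using fin by (intro sum.remove) auto
    finally have eq: "T (d, e) = hom_component (d + e) (f * g) - (\<Sum>p\<in>?D \<times> ?E - {(d, e)}. T p)"
      by simp
    have "T (i, j) \<in> P" if "(i, j) \<noteq> (d, e)" for i j
    proof (cases "i + j = d + e")
      case True
      then have "hom_component i f \<in> P \<or> hom_component j g \<in> P"
        using that d(2)[of i] e(2)[of j] by fastforce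
      then show ?thesis
        using True ideal_mult[OF P hom_component_in_polys[OF fg(1)]]
          ideal_mult2[OF P _ hom_component_in_polys[OF fg(2)]]
        by (auto simp: T)
    next
      case False
      then show ?thesis
        using ideal_zero[OF P] by (simp add: T)
    qed
    then have "(\<Sum>p\<in>?D \<times> ?E - {(d, e)}. T p) \<in> P"
      by (intro ideal_sum[OF P]) auto
    moreover have "hom_component (d + e) (f * g) \<in> P"
      using hom fg(3) by (simp add: homogeneous_ideal_def)
    ultimately have "T (d, e) \<in> P"
      unfolding eq by (intro ideal_diff[OF P])
    then have "hom_component d f * hom_component e g \<in> P"
      by (simp add: T)
    then show False
      using prime[of "hom_component d f" d "hom_component e g" e] d(1) e(1) fg
      by (auto simp: forms_def hom_component_in_polys)
  qed
  then show ?thesis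
    using P assms(2) by (auto simp: primeideal_poly_ring_iff)
qed

lemma lookup_contract:
  fixes \<Phi> F :: "('v, 'k::field) mpoly"
  shows "lookup (\<Phi> \<circ>\<^sub>c F) m = (\<Sum>a\<in>keys \<Phi>. lookup \<Phi> a * lookup F (a + m))"
proof -
  have term_eq: "lookup (single 0 c * contract_monom a b) m = (if b = a + m then c else 0)"
    for c :: 'k and a b :: "'v \<Rightarrow>\<^sub>0 nat"
  proof (cases "b = a + m")
    case True
    then show ?thesis
      by (simp add: contract_monom_def mult_single lookup_add)
  next
    case False
    have "\<not> (\<forall>v. lookup a v \<le> lookup b v) \<or> b - a \<noteq> m"
      using False monomial_split[of a b] by auto
    then show ?thesis
      using False by (auto simp: contract_monom_def mult_single lookup_single when_def)
  qed
  have "lookup (\<Phi> \<circ>\<^sub>c F) m =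
      (\<Sum>a\<in>keys \<Phi>. \<Sum>b\<in>keys F. if b = a + m then lookup \<Phi> a * lookup F b else 0)"
    unfolding contract_def lookup_sum term_eq ..
  also have "\<dots> = (\<Sum>a\<in>keys \<Phi>. lookup \<Phi> a * lookup F (a + m))"
    by (intro sum.cong refl) (auto simp: in_keys_iff)
  finally show ?thesis .
qed

lemma lookup_contract_superset:
  assumes "finite A" "keys \<Phi> \<subseteq> A"
  shows "lookup (\<Phi> \<circ>\<^sub>c F) m = (\<Sum>a\<in>A. lookup \<Phi> a * lookup F (a + m))"
  unfolding lookup_contract using assms by (intro sum.mono_neutral_left) (auto simp: in_keys_iff)

lemma lookup_single_contract: "lookup (single a c \<circ>\<^sub>c F) m = c * lookup F (a + m)"
  using lookup_contract_superset[of "{a}" "single a c" F m] by simp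

lemma contract_add: "(\<Phi> + \<Psi>) \<circ>\<^sub>c F = \<Phi> \<circ>\<^sub>c F + \<Psi> \<circ>\<^sub>c F"
proof (rule poly_mapping_eqI)
  fix m
  let ?A = "keys \<Phi> \<union> keys \<Psi>"
  show "lookup ((\<Phi> + \<Psi>) \<circ>\<^sub>c F) m = lookup (\<Phi> \<circ>\<^sub>c F + \<Psi> \<circ>\<^sub>c F) m"
    using keys_add[of \<Phi> \<Psi>]
    by (simp add: lookup_contract_superset[of ?A] lookup_add sum.distrib algebra_simps)
qed

lemma contract_0 [simp]: "0 \<circ>\<^sub>c F = 0"
  by (rule poly_mapping_eqI) (simp add: lookup_contract)

lemma contract_0_right [simp]: "\<Phi> \<circ>\<^sub>c 0 = 0"
  by (rule poly_mapping_eqI) (simp add: lookup_contract)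

lemma contract_sum: "sum f A \<circ>\<^sub>c F = (\<Sum>i\<in>A. f i \<circ>\<^sub>c F)"
  by (induction A rule: infinite_finite_induct) (simp_all add: contract_add)

lemma contract_mult: "(\<Phi> * \<Psi>) \<circ>\<^sub>c F = \<Phi> \<circ>\<^sub>c (\<Psi> \<circ>\<^sub>c F)"
proof (rule poly_mapping_eqI)
  fix m
  let ?A = "(\<lambda>(a, b). a + b) ` (keys \<Phi> \<times> keys \<Psi>)"
  have "keys (\<Phi> * \<Psi>) \<subseteq> ?A"
    using keys_mult[of \<Phi> \<Psi>] by auto
  then have "lookup ((\<Phi> * \<Psi>) \<circ>\<^sub>c F) m = (\<Sum>q\<in>?A. lookup (\<Phi> * \<Psi>) q * lookup F (q + m))"
    by (intro lookup_contract_superset) auto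
  also have "\<dots> = (\<Sum>q\<in>?A. \<Sum>a\<in>keys \<Phi>. \<Sum>b\<in>keys \<Psi>.
      if a + b = q then lookup \<Phi> a * lookup \<Psi> b * lookup F (q + m) else 0)"
    unfolding lookup_mult_sum sum_distrib_right by (intro sum.cong refl) simp
  also have "\<dots> = (\<Sum>a\<in>keys \<Phi>. \<Sum>b\<in>keys \<Psi>. \<Sum>q\<in>?A.
      if a + b = q then lookup \<Phi> a * lookup \<Psi> b * lookup F (q + m) else 0)"
    by (rule trans[OF sum.swap sum.cong[OF refl sum.swap]])
  also have "\<dots> = (\<Sum>a\<in>keys \<Phi>. \<Sum>b\<in>keys \<Psi>. lookup \<Phi> a * lookup \<Psi> b * lookup F (a + b + m))"
  proof (intro sum.cong refl)
    fix a b assume ab: "a \<in> keys \<Phi>" "b \<in> keys \<Psi>"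
    then have "a + b \<in> ?A"
      by force
    then show "(\<Sum>q\<in>?A. if a + b = q then lookup \<Phi> a * lookup \<Psi> b * lookup F (q + m) else 0) =
        lookup \<Phi> a * lookup \<Psi> b * lookup F (a + b + m)"
      by simp
  qed
  also have "\<dots> = lookup (\<Phi> \<circ>\<^sub>c (\<Psi> \<circ>\<^sub>c F)) m"
    by (simp add: lookup_contract sum_distrib_left mult.assoc add_ac)
  finally show "lookup ((\<Phi> * \<Psi>) \<circ>\<^sub>c F) m = lookup (\<Phi> \<circ>\<^sub>c (\<Psi> \<circ>\<^sub>c F)) m" .
qed

lemma contract_const: "single 0 c \<circ>\<^sub>c F = single 0 c * F"
  by (rule poly_mapping_eqI) (simp add: lookup_single_contract lookup_scale)

lemma linear_contract:
  "Vector_Spaces.linear (\<lambda>c f. single 0 c * f) (\<lambda>c f. single 0 c * f)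
     (\<lambda>\<Phi>. \<Phi> \<circ>\<^sub>c F :: ('v, 'k::field) mpoly)"
  by unfold_locales (simp_all add: contract_add contract_mult contract_const)

lemma ideal_Ann: "ideal (Ann V F) (poly_ring V)"
  by (auto simp: ideal_poly_ring_iff Ann_def contract_add contract_mult intro: add_in_polys mult_in_polys)

lemma homogeneous_ideal_Ann:
  assumes F: "homogeneous e F"
  shows "homogeneous_ideal V (Ann V F)"
  unfolding homogeneous_ideal_def
proof (intro conjI ballI allI ideal_Ann)
  fix \<Phi> :: "('a, 'b) mpoly" and d assume \<Phi>: "\<Phi> \<in> Ann V F"
  have "hom_component d \<Phi> \<circ>\<^sub>c F = 0"
  proof (rule poly_mapping_eqI)
    fix m
    have *: "lookup (hom_component d \<Phi> \<circ>\<^sub>c F) m =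
        (\<Sum>a\<in>keys \<Phi>. if mdeg a = d then lookup \<Phi> a * lookup F (a + m) else 0)"
      by (subst lookup_contract_superset[of "keys \<Phi>"])
        (auto simp: keys_hom_component lookup_hom_component intro: sum.cong)
    have F0: "lookup F (a + m) = 0" if "mdeg a + mdeg m \<noteq> e" for a
      using F that by (auto simp: homogeneous_def in_keys_iff simp flip: mdeg_add)
    show "lookup (hom_component d \<Phi> \<circ>\<^sub>c F) m = lookup 0 m"
    proof (cases "d + mdeg m = e")
      case True
      then have "lookup (hom_component d \<Phi> \<circ>\<^sub>c F) m = lookup (\<Phi> \<circ>\<^sub>c F) m"
        unfolding * unfolding lookup_contract using F0 by (intro sum.cong refl) auto
      then show ?thesis
        using \<Phi> by (simp add: Ann_def)
    next
      case False
      then show ?thesis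
        unfolding * using F0 by (simp add: sum.neutral)
    qed
  qed
  then show "hom_component d \<Phi> \<in> Ann V F"
    using \<Phi> by (simp add: Ann_def hom_component_in_polys)
qed

section \<open>Points and the length of a scheme\<close>

lemma homogeneous_ideal_add_principal:
  fixes M :: "('v, 'k::field) mpoly set"
  assumes M: "homogeneous_ideal V M" and a: "a \<in> forms V d"
  shows "homogeneous_ideal V {m + r * a | m r. m \<in> M \<and> r \<in> polys V}" (is "homogeneous_ideal V ?J")
proof -
  have I: "ideal M (poly_ring V)"
    using M by (simp add: homogeneous_ideal_def)
  have a': "a \<in> polys V" "homogeneous d a"
    using a by (auto simp: forms_def)
  have memI: "m + r * a \<in> ?J" if "m \<in> M" "r \<in> polys V" for m r
    using that by blast
  have "ideal ?J (poly_ring V)"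
    unfolding ideal_poly_ring_iff
  proof (intro conjI ballI subsetI)
    fix f assume "f \<in> ?J"
    then show "f \<in> polys V"
      using a' ideal_subset_polys[OF I] by (auto intro: add_in_polys mult_in_polys)
  next
    show "0 \<in> ?J"
      using memI[OF ideal_zero[OF I] zero_in_polys] by simp
  next
    fix f g assume "f \<in> ?J" "g \<in> ?J"
    then obtain m r n s where "f = m + r * a" "m \<in> M" "r \<in> polys V" "g = n + s * a" "n \<in> M" "s \<in> polys V"
      by blast
    then show "f + g \<in> ?J"
      using memI[of "m + n" "r + s"] ideal_add[OF I] by (simp add: algebra_simps add_in_polys)
  next
    fix f g :: "('v, 'k) mpoly" assume "f \<in> polys V" "g \<in> ?J"
    moreover from this obtain n s where "g = n + s * a" "n \<in> M" "s \<in> polys V"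
      by blast
    ultimately show "f * g \<in> ?J"
      using memI[of "f * n" "f * s"] ideal_mult[OF I] by (simp add: algebra_simps mult_in_polys)
  qed
  moreover have "hom_component i f \<in> ?J" if f: "f \<in> ?J" for f i
  proof -
    obtain m r where mr: "f = m + r * a" "m \<in> M" "r \<in> polys V"
      using f by blast
    then have m: "hom_component i m \<in> M"
      using M by (simp add: homogeneous_ideal_def)
    show ?thesis
    proof (cases "d \<le> i")
      case True
      then have "hom_component i f = hom_component i m + hom_component (i - d) r * a"
        using hom_component_mult_homogeneous[OF a'(2), of "i - d" r] mr(1)
        by (simp add: hom_component_add)
      then show ?thesis
        using memI[OF m hom_component_in_polys[OF mr(3)]] by simp
    next
      case False
      then have "hom_component i f = hom_component i m + 0 * a"
        using hom_component_mult_homogeneous_less[OF a'(2), of i r] mr(1)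
        by (simp add: hom_component_add)
      then show ?thesis
        using memI[OF m zero_in_polys] by simp
    qed
  qed
  ultimately show ?thesis
    by (simp add: homogeneous_ideal_def)
qed

lemma homogeneous_prime_avoiding_powers:
  fixes Q :: "('v, 'k::field) mpoly set"
  assumes Q: "homogeneous_ideal V Q" and v: "v \<in> V" "\<And>n. var v ^ n \<notin> Q"
  obtains P where "homogeneous_ideal V P" "primeideal P (poly_ring V)" "Q \<subseteq> P" "var v \<notin> P"
proof -
  define \<A> where "\<A> = {J. homogeneous_ideal V J \<and> Q \<subseteq> J \<and> (\<forall>n. var v ^ n \<notin> J)}"
  have "\<Union>\<C> \<in> \<A>" if \<C>: "\<C> \<noteq> {}" "subset.chain \<A> \<C>" for \<C>
  proof -
    have el: "homogeneous_ideal V J" "ideal J (poly_ring V)" "Q \<subseteq> J" "\<And>n. var v ^ n \<notin> J" if "J \<in> \<C>" for J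
      using that \<C>(2) by (auto simp: subset.chain_def \<A>_def homogeneous_ideal_def)
    have "ideal (\<Union>\<C>) (poly_ring V)"
      unfolding ideal_poly_ring_iff
    proof (intro conjI ballI)
      show "\<Union>\<C> \<subseteq> polys V"
        using ideal_subset_polys[OF el(2)] by blast
      show "0 \<in> \<Union>\<C>"
        using \<C>(1) ideal_zero[OF el(2)] by blast
    next
      fix f g assume "f \<in> \<Union>\<C>" "g \<in> \<Union>\<C>"
      then obtain J K where JK: "J \<in> \<C>" "f \<in> J" "K \<in> \<C>" "g \<in> K"
        by blast
      then have "J \<subseteq> K \<or> K \<subseteq> J"
        using \<C>(2) by (auto simp: subset.chain_def)
      then show "f + g \<in> \<Union>\<C>"
        using JK ideal_add[OF el(2)] by blast
    next
      fix f g :: "('v, 'k) mpoly" assume "f \<in> polys V" "g \<in> \<Union>\<C>"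
      then show "f * g \<in> \<Union>\<C>"
        using ideal_mult[OF el(2)] by blast
    qed
    moreover have "hom_component d f \<in> \<Union>\<C>" if "f \<in> \<Union>\<C>" for f d
      using that el(1) by (auto simp: homogeneous_ideal_def)
    moreover have "Q \<subseteq> \<Union>\<C>" "\<And>n. var v ^ n \<notin> \<Union>\<C>"
      using \<C>(1) el(3,4) by blast+
    ultimately show ?thesis
      by (simp add: \<A>_def homogeneous_ideal_def)
  qed
  moreover have "\<A> \<noteq> {}"
    using Q v by (auto simp: \<A>_def)
  ultimately obtain M where M: "M \<in> \<A>" "\<And>J. J \<in> \<A> \<Longrightarrow> M \<subseteq> J \<Longrightarrow> J = M"
    using subset_Zorn_nonempty[of \<A>] by blast
  have hom: "homogeneous_ideal V M" and I: "ideal M (poly_ring V)" and "Q \<subseteq> M"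
    and avoid: "\<And>n. var v ^ n \<notin> M"
    using M(1) by (auto simp: \<A>_def homogeneous_ideal_def)
  have power_in: "\<exists>n m r. var v ^ n = m + r * a \<and> m \<in> M \<and> r \<in> polys V" if a: "a \<in> forms V d" "a \<notin> M" for a d
  proof -
    let ?J = "{m + r * a | m r. m \<in> M \<and> r \<in> polys V}"
    have "M \<subseteq> ?J"
    proof
      fix m assume "m \<in> M"
      then have "m + 0 * a \<in> ?J"
        using zero_in_polys by blast
      then show "m \<in> ?J"
        by simp
    qed
    moreover have "0 + 1 * a \<in> ?J"
      using ideal_zero[OF I] one_in_polys by blast
    then have "a \<in> ?J"
      by simp
    ultimately have "?J \<notin> \<A>"
      using M(2)[of ?J] a(2) by blast
    then show ?thesis
      using homogeneous_ideal_add_principal[OF hom a(1)] \<open>M \<subseteq> ?J\<close> \<open>Q \<subseteq> M\<close> by (auto simp: \<A>_def)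
  qed
  have "primeideal M (poly_ring V)"
  proof (rule primeideal_homogeneousI[OF hom])
    show "1 \<notin> M"
      using avoid[of 0] by simp
    fix a b d e assume ab: "a \<in> forms V d" "b \<in> forms V e" "a * b \<in> M"
    show "a \<in> M \<or> b \<in> M"
    proof (rule ccontr)
      assume "\<not> (a \<in> M \<or> b \<in> M)"
      then obtain i m r j n s where 1: "var v ^ i = m + r * a" "m \<in> M" "r \<in> polys V"
        and 2: "var v ^ j = n + s * b" "n \<in> M" "s \<in> polys V"
        using power_in ab(1,2) by metis
      have "var v ^ (i + j) = m * var v ^ j + (r * a) * n + (r * s) * (a * b)"
        unfolding power_add 1(1) 2(1) by (simp add: algebra_simps)
      moreover have "m * var v ^ j \<in> M"
        using 1(2) v(1) by (intro ideal_mult2[OF I] power_in_polys var_in_polys)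
      moreover have "(r * a) * n \<in> M" "(r * s) * (a * b) \<in> M"
        using 1 2 ab by (auto simp: forms_def intro!: ideal_mult[OF I] mult_in_polys)
      ultimately show False
        using avoid[of "i + j"] ideal_add[OF I] by metis
    qed
  qed
  then show thesis
    using that[OF hom _ \<open>Q \<subseteq> M\<close>] avoid[of 1] by simp
qed

lemma exists_point_not_vanishing:
  assumes "finite V" and I: "closed_subscheme V I" and f: "f \<in> forms V d" "f \<notin> I"
  shows "\<exists>P\<in>points V I. \<forall>g\<in>polys V - P. g * f \<notin> I"
proof -
  have hI: "homogeneous_ideal V I" and iI: "ideal I (poly_ring V)" and sat: "saturated V I"
    using I by (auto simp: closed_subscheme_def homogeneous_ideal_def)
  have f': "f \<in> polys V" "homogeneous d f"
    using f by (auto simp: forms_def)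
  obtain v where v: "v \<in> V" "\<And>n. var v ^ n * f \<notin> I"
    using saturated_powers[OF assms(1) iI sat f'(1)] f(2) by blast
  define Q where "Q = {g \<in> polys V. g * f \<in> I}"
  have "homogeneous_ideal V Q"
    unfolding homogeneous_ideal_def
  proof
    show "ideal Q (poly_ring V)"
      using ideal_zero[OF iI] ideal_add[OF iI] ideal_mult[OF iI]
      by (auto simp: ideal_poly_ring_iff Q_def add_in_polys mult_in_polys distrib_right mult.assoc)
    show "\<forall>g\<in>Q. \<forall>i. hom_component i g \<in> Q"
      using hI hom_component_mult_homogeneous[OF f'(2), symmetric]
      by (auto simp: Q_def homogeneous_ideal_def hom_component_in_polys)
  qed
  moreover have "var v ^ n \<notin> Q" for n
    using v(2) by (simp add: Q_def)
  ultimately obtain P where P: "homogeneous_ideal V P" "primeideal P (poly_ring V)" "Q \<subseteq> P" "var v \<notin> P"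
    using homogeneous_prime_avoiding_powers[OF _ v(1)] by blast
  have "I \<subseteq> Q"
    using ideal_mult2[OF iI _ f'(1)] ideal_subset_polys[OF iI] by (auto simp: Q_def)
  then have "P \<in> points V I"
    using P v(1) irrelevant_ideal_subset_iff[of P V] by (auto simp: points_def homogeneous_ideal_def)
  moreover have "\<forall>g\<in>polys V - P. g * f \<notin> I"
    using P(3) by (auto simp: Q_def)
  ultimately show ?thesis
    by blast
qed

definition local_kernel :: "'v set \<Rightarrow> ('v, 'k::field) mpoly set \<Rightarrow> ('v, 'k) mpoly set \<Rightarrow> ('v, 'k) mpoly set" where
  "local_kernel V I P = {f \<in> polys V. \<exists>g\<in>polys V - P. g * f \<in> I}"

lemma subspace_local_kernel:
  assumes I: "ideal I (poly_ring V)" and P: "primeideal P (poly_ring V)"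
  shows "mpoly.subspace (local_kernel V I P)"
proof -
  have iP: "ideal P (poly_ring V)" "P \<noteq> polys V"
    and prime: "\<And>f g. f \<in> polys V \<Longrightarrow> g \<in> polys V \<Longrightarrow> f * g \<in> P \<Longrightarrow> f \<in> P \<or> g \<in> P"
    using P by (auto simp: primeideal_poly_ring_iff)
  have "1 \<notin> P"
    by (rule one_notin_primeideal[OF P])
  show ?thesis
    unfolding mpoly.subspace_def
  proof (intro conjI ballI allI)
    show "0 \<in> local_kernel V I P"
      using \<open>1 \<notin> P\<close> ideal_zero[OF I] by (auto simp: local_kernel_def intro!: exI[of _ 1])
  next
    fix f f' assume "f \<in> local_kernel V I P" "f' \<in> local_kernel V I P"
    then obtain g g' where g: "f \<in> polys V" "g \<in> polys V - P" "g * f \<in> I"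
      "f' \<in> polys V" "g' \<in> polys V - P" "g' * f' \<in> I"
      by (auto simp: local_kernel_def)
    have "(g * g') * (f + f') = g' * (g * f) + g * (g' * f')"
      by (simp add: algebra_simps)
    also have "\<dots> \<in> I"
      using g by (intro ideal_add[OF I] ideal_mult[OF I _ g(3)] ideal_mult[OF I _ g(6)]) auto
    finally have "(g * g') * (f + f') \<in> I" .
    moreover have "g * g' \<in> polys V - P"
      using g prime by (auto intro: mult_in_polys)
    ultimately show "f + f' \<in> local_kernel V I P"
      using g by (auto simp: local_kernel_def intro: add_in_polys)
  next
    fix c f assume "f \<in> local_kernel V I P"
    then obtain g where g: "f \<in> polys V" "g \<in> polys V - P" "g * f \<in> I"
      by (auto simp: local_kernel_def)
    have "g * (single 0 c * f) = single 0 c * (g * f)"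
      by (simp add: algebra_simps)
    also have "\<dots> \<in> I"
      by (rule ideal_mult[OF I const_in_polys g(3)])
    finally show "single 0 c * f \<in> local_kernel V I P"
      using g by (auto simp: local_kernel_def intro: mult_in_polys)
  qed
qed

lemma sum_Fract:
  assumes "(y :: 'a::idom) \<noteq> 0"
  shows "(\<Sum>z\<in>Z. Fract (a z) y) = Fract (\<Sum>z\<in>Z. a z) y"
proof (induction Z rule: infinite_finite_induct)
  case (insert z Z)
  then show ?case
    using assms by (simp add: eq_fract algebra_simps)
qed (use assms in \<open>auto simp: fract_collapse\<close>)

lemma scalar_mult_Fract: "scalar c * Fract z y = Fract (single 0 c * z) y"
  by (simp add: scalar_def)

lemma card_le_quotient_dim:
  fixes I :: "('v::linorder, 'k::field) mpoly set"
  assumes I: "ideal I (poly_ring V)" and P: "P \<in> points V I"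
    and Z: "finite Z" "Z \<subseteq> forms V d"
    and ind: "\<And>c. (\<Sum>z\<in>Z. single 0 (c z) * z) \<in> local_kernel V I P \<Longrightarrow> \<forall>z\<in>Z. c z = 0"
  shows "enat (card Z) \<le> quotient_dim (local_ring V P) (ideal_stalk V I P)"
proof -
  have iP: "ideal P (poly_ring V)" and pP: "primeideal P (poly_ring V)"
    using P by (auto simp: points_def homogeneous_ideal_def)
  obtain v where v: "v \<in> V" "var v \<notin> P"
    using P irrelevant_ideal_subset_iff[OF iP] by (auto simp: points_def)
  define y :: "('v, 'k) mpoly" where "y = var v ^ d"
  have yV: "y \<in> polys V"
    unfolding y_def using v(1) by (intro power_in_polys var_in_polys)
  have "var v ^ d \<notin> P"
    by (rule power_notin_primeideal[OF pP var_in_polys[OF v(1)] v(2)])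
  then have yP: "y \<notin> P"
    by (simp add: y_def)
  then have y0: "y \<noteq> 0"
    using ideal_zero[OF iP] by blast
  define \<phi> where "\<phi> z = Fract z y" for z
  have inj: "inj_on \<phi> Z"
    using y0 by (auto simp: inj_on_def \<phi>_def eq_fract)
  have sub: "\<phi> ` Z \<subseteq> local_ring V P"
  proof
    fix b assume "b \<in> \<phi> ` Z"
    then obtain z where z: "b = Fract z y" "z \<in> forms V d"
      using Z(2) by (auto simp: \<phi>_def)
    then show "b \<in> local_ring V P"
      using yV yP homogeneous_var_power[of d v] unfolding local_ring_def y_def forms_def by blast
  qed
  have "independent_mod (ideal_stalk V I P) (\<phi> ` Z)"
    unfolding independent_mod_def
  proof (intro allI impI)
    fix c assume "(\<Sum>b\<in>\<phi> ` Z. scalar (c b) * b) \<in> ideal_stalk V I P"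
    moreover have "(\<Sum>b\<in>\<phi> ` Z. scalar (c b) * b) = (\<Sum>z\<in>Z. scalar (c (\<phi> z)) * \<phi> z)"
      by (simp add: sum.reindex[OF inj])
    moreover have "(\<Sum>z\<in>Z. scalar (c (\<phi> z)) * \<phi> z) = Fract (\<Sum>z\<in>Z. single 0 (c (\<phi> z)) * z) y"
      unfolding \<phi>_def scalar_mult_Fract by (rule sum_Fract[OF y0])
    ultimately obtain f g where fg: "Fract (\<Sum>z\<in>Z. single 0 (c (\<phi> z)) * z) y = Fract f g"
      "f \<in> I" "g \<in> polys V - P"
      unfolding ideal_stalk_def by auto
    have "g \<noteq> 0"
      using fg(3) ideal_zero[OF iP] by blast
    then have "g * (\<Sum>z\<in>Z. single 0 (c (\<phi> z)) * z) = f * y"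
      using fg(1) y0 by (simp add: eq_fract mult.commute)
    then have "g * (\<Sum>z\<in>Z. single 0 (c (\<phi> z)) * z) \<in> I"
      using ideal_mult2[OF I fg(2) yV] by simp
    moreover have "(\<Sum>z\<in>Z. single 0 (c (\<phi> z)) * z) \<in> polys V"
      using Z(2) by (intro sum_in_polys mult_in_polys) (auto simp: forms_def)
    ultimately have "(\<Sum>z\<in>Z. single 0 (c (\<phi> z)) * z) \<in> local_kernel V I P"
      using fg(3) by (auto simp: local_kernel_def)
    then show "\<forall>b\<in>\<phi> ` Z. c b = 0"
      using ind[of "c \<circ> \<phi>"] by simp
  qed
  then have "enat (card (\<phi> ` Z)) \<le> quotient_dim (local_ring V P) (ideal_stalk V I P)"
    unfolding quotient_dim_def using Z(1) sub by (intro SUP_upper) auto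
  then show ?thesis
    by (simp add: card_image[OF inj])
qed

lemma finite_span_forms:
  assumes "finite V" "U \<subseteq> forms V d"
  obtains A where "finite A" "U \<subseteq> mpoly.span A"
proof (rule that)
  show "finite ((\<lambda>m. single m 1 :: ('a, 'b) mpoly) ` monomials V d)"
    using finite_monomials[OF assms(1)] by simp
  show "U \<subseteq> mpoly.span ((\<lambda>m. single m 1) ` monomials V d)"
    using assms(2) forms_span by blast
qed

lemma dim_le_sum_quotient_dim:
  fixes I :: "('v::linorder, 'k::field) mpoly set"
  assumes V: "finite V" and I: "closed_subscheme V I"
    and "mpoly.subspace U" "U \<subseteq> forms V d" "U \<inter> I \<subseteq> {0}"
  shows "\<exists>A\<subseteq>points V I. finite A \<and> (\<forall>P\<in>A. \<not> U \<subseteq> local_kernel V I P) \<and>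
    enat (mpoly.dim U) \<le> (\<Sum>P\<in>A. quotient_dim (local_ring V P) (ideal_stalk V I P))"
  using assms(3-)
proof (induction "mpoly.dim U" arbitrary: U rule: less_induct)
  case less
  have iI: "ideal I (poly_ring V)"
    using I by (auto simp: closed_subscheme_def homogeneous_ideal_def)
  obtain C where C: "finite C" "U \<subseteq> mpoly.span C"
    using finite_span_forms[OF V less.prems(2)] .
  show ?case
  proof (cases "U \<subseteq> {0}")
    case True
    then have "mpoly.dim U = 0"
      using mpoly.dim_le_card[of U "{}"] by simp
    then show ?thesis
      by (intro exI[of _ "{}"]) (simp add: zero_enat_def)
  next
    case False
    then obtain u where u: "u \<in> U" "u \<noteq> 0"
      by blast
    then have "u \<notin> I"
      using less.prems(3) by blast
    then obtain P where P: "P \<in> points V I" "\<forall>g\<in>polys V - P. g * u \<notin> I"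
      using exists_point_not_vanishing[OF V I, of u d] u(1) less.prems(2) by blast
    then have uK: "u \<notin> local_kernel V I P"
      by (auto simp: local_kernel_def)
    define U' where "U' = U \<inter> local_kernel V I P"
    have sK: "mpoly.subspace (local_kernel V I P)"
      using subspace_local_kernel[OF iI] P(1) by (simp add: points_def)
    have sU': "mpoly.subspace U'"
      unfolding U'_def by (intro mpoly.subspace_inter less.prems(1) sK)
    have sub: "U' \<subseteq> U"
      by (simp add: U'_def)
    have "card {u} + mpoly.dim U' \<le> mpoly.dim U"
    proof (rule mpoly.card_add_dim_le_dim[where h = "\<lambda>x. x", OF sU' sub C])
      fix c assume c: "(\<Sum>b\<in>{u}. single 0 (c b) * b) \<in> U'"
      show "\<forall>b\<in>{u}. c b = 0"
      proof (rule ccontr)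
        assume "\<not> (\<forall>b\<in>{u}. c b = 0)"
        then have "inverse (c u) * c u = 1"
          by simp
        then have "single 0 (inverse (c u)) * (single 0 (c u) * u) = u"
          by (simp only: mpoly.scale_scale mpoly.scale_one)
        moreover have "single 0 (inverse (c u)) * (single 0 (c u) * u) \<in> U'"
          by (rule mpoly.subspace_scale[OF sU']) (use c in simp)
        ultimately have "u \<in> U'"
          by metis
        then show False
          using uK by (simp add: U'_def)
      qed
    qed (use u in auto)
    then have less_dim: "mpoly.dim U' < mpoly.dim U"
      by simp
    obtain A where A: "A \<subseteq> points V I" "finite A" "\<forall>P\<in>A. \<not> U' \<subseteq> local_kernel V I P"
      "enat (mpoly.dim U') \<le> (\<Sum>P\<in>A. quotient_dim (local_ring V P) (ideal_stalk V I P))"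
      using less.hyps[OF less_dim sU'] sub less.prems(2,3) by blast
    obtain Z where Z: "finite Z" "Z \<subseteq> U" "mpoly.dim U = mpoly.dim U' + card Z"
      "\<And>c. (\<Sum>z\<in>Z. single 0 (c z) * z) \<in> U' \<Longrightarrow> \<forall>z\<in>Z. c z = 0"
      using mpoly.complement_basis[OF sU' sub C] by blast
    have "enat (card Z) \<le> quotient_dim (local_ring V P) (ideal_stalk V I P)"
    proof (rule card_le_quotient_dim[OF iI P(1) Z(1)])
      show "Z \<subseteq> forms V d"
        using Z(2) less.prems(2) by blast
      fix c assume c: "(\<Sum>z\<in>Z. single 0 (c z) * z) \<in> local_kernel V I P"
      have "(\<Sum>z\<in>Z. single 0 (c z) * z) \<in> U"
        using Z(2) less.prems(1) by (intro mpoly.subspace_sum mpoly.subspace_scale) auto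
      then show "\<forall>z\<in>Z. c z = 0"
        using c Z(4) by (simp add: U'_def)
    qed
    moreover have "P \<notin> A"
      using A(3) by (auto simp: U'_def)
    ultimately have "enat (mpoly.dim U) \<le>
        (\<Sum>P\<in>insert P A. quotient_dim (local_ring V P) (ideal_stalk V I P))"
      using A(2,4) Z(3) by (simp add: add.commute add_mono flip: plus_enat_simps)
    moreover have "\<forall>P\<in>insert P A. \<not> U \<subseteq> local_kernel V I P"
      using A(3) sub u(1) uK by blast
    ultimately show ?thesis
      using A(1,2) P(1) by (intro exI[of _ "insert P A"]) auto
  qed
qed

lemma dim_forms_le_scheme_length:
  fixes I :: "('v::linorder, 'k::field) mpoly set"
  assumes V: "finite V" and I: "closed_subscheme V I"
  shows "enat (mpoly.dim (forms V d :: ('v, 'k) mpoly set)) \<le>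
    enat (mpoly.dim (I \<inter> forms V d)) + scheme_length V I"
proof -
  have iI: "ideal I (poly_ring V)"
    using I by (auto simp: closed_subscheme_def homogeneous_ideal_def)
  have sI: "mpoly.subspace (I \<inter> forms V d)"
    by (intro mpoly.subspace_inter subspace_ideal[OF iI] subspace_forms)
  obtain C where C: "finite C" "forms V d \<subseteq> mpoly.span (C :: ('v, 'k) mpoly set)"
    using finite_span_forms[OF V subset_refl] .
  obtain Z where Z: "finite Z" "Z \<subseteq> forms V d"
    "mpoly.dim (forms V d :: ('v, 'k) mpoly set) = mpoly.dim (I \<inter> forms V d) + card Z"
    "\<And>c. (\<Sum>z\<in>Z. single 0 (c z) * z) \<in> I \<inter> forms V d \<Longrightarrow> \<forall>z\<in>Z. c z = 0"
    using mpoly.complement_basis[OF sI Int_lower2 C] by blast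
  have ZU: "mpoly.span Z \<subseteq> forms V d"
    using mpoly.span_minimal[OF Z(2) subspace_forms] .
  have "mpoly.span Z \<inter> I \<subseteq> {0}"
  proof
    fix f assume f: "f \<in> mpoly.span Z \<inter> I"
    then obtain c where c: "f = (\<Sum>z\<in>Z. single 0 (c z) * z)"
      using mpoly.span_image_sum[OF Z(1), of f "\<lambda>x. x"] by auto
    have "f \<in> I \<inter> forms V d"
      using f ZU by blast
    then have "\<forall>z\<in>Z. c z = 0"
      unfolding c by (rule Z(4))
    then show "f \<in> {0}"
      unfolding c by simp
  qed
  from dim_le_sum_quotient_dim[OF V I mpoly.subspace_span ZU this]
  obtain A where A: "A \<subseteq> points V I" "finite A"
    "enat (mpoly.dim (mpoly.span Z)) \<le> (\<Sum>P\<in>A. quotient_dim (local_ring V P) (ideal_stalk V I P))"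
    by (elim exE conjE)
  have "card Z + mpoly.dim {0 :: ('v, 'k) mpoly} \<le> mpoly.dim (mpoly.span Z)"
  proof (rule mpoly.card_add_dim_le_dim[where h = "\<lambda>x. x" and A = Z])
    fix c assume "(\<Sum>b\<in>Z. single 0 (c b) * b) \<in> {0}"
    moreover have "0 \<in> I \<inter> forms V d"
      by (rule mpoly.subspace_0[OF sI])
    ultimately show "\<forall>b\<in>Z. c b = 0"
      by (intro Z(4)) simp
  next
    show "mpoly.subspace {0 :: ('v, 'k) mpoly}"
      by (rule mpoly.subspace_single_0)
    show "(\<lambda>x. x) ` Z \<subseteq> mpoly.span Z"
      using mpoly.span_superset by simp
  qed (use Z(1) mpoly.span_zero in auto)
  then have "enat (card Z) \<le> enat (mpoly.dim (mpoly.span Z))"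
    by simp
  also have "\<dots> \<le> (\<Sum>P\<in>A. quotient_dim (local_ring V P) (ideal_stalk V I P))"
    by (rule A(3))
  also have "(\<Sum>P\<in>A. quotient_dim (local_ring V P) (ideal_stalk V I P)) \<le> scheme_length V I"
    unfolding scheme_length_def using A(1,2) by (intro SUP_upper) auto
  finally have "enat (card Z) \<le> scheme_length V I" .
  then have "enat (mpoly.dim (I \<inter> forms V d)) + enat (card Z) \<le>
      enat (mpoly.dim (I \<inter> forms V d)) + scheme_length V I"
    by (rule add_left_mono)
  then show ?thesis
    by (simp add: Z(3))
qed

lemma dim_ideal_saturation_step:
  fixes I J :: "('v, 'k::field) mpoly set"
  assumes V: "finite V" and I: "ideal I (poly_ring V)" "saturated V I"
    and J: "ideal J (poly_ring V)" "I \<subseteq> J" "\<And>v. v \<in> V \<Longrightarrow> var v ^ e \<in> J"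
  shows "mpoly.dim (forms V d :: ('v, 'k) mpoly set) + mpoly.dim (I \<inter> forms V (d + e)) \<le>
    mpoly.dim (I \<inter> forms V d) + mpoly.dim (J \<inter> forms V (d + e))"
proof -
  define S where "S W = {f \<in> polys V. \<forall>v\<in>W. \<exists>n. var v ^ n * f \<in> I}" for W
  have iS: "ideal (S W) (poly_ring V)" if "W \<subseteq> V" for W
    unfolding ideal_poly_ring_iff
  proof (intro conjI ballI)
    show "S W \<subseteq> polys V" "0 \<in> S W"
      using ideal_zero[OF I(1)] by (auto simp: S_def)
  next
    fix f g assume fg: "f \<in> S W" "g \<in> S W"
    have "\<exists>n. var v ^ n * (f + g) \<in> I" if v: "v \<in> W" for v
    proof -
      obtain i j where ij: "var v ^ i * f \<in> I" "var v ^ j * g \<in> I"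
        using fg v unfolding S_def by blast
      have vV: "var v ^ n \<in> polys V" for n
        using v \<open>W \<subseteq> V\<close> by (intro power_in_polys var_in_polys) auto
      have "var v ^ j * (var v ^ i * f) + var v ^ i * (var v ^ j * g) \<in> I"
        by (rule ideal_add[OF I(1) ideal_mult[OF I(1) vV ij(1)] ideal_mult[OF I(1) vV ij(2)]])
      moreover have "var v ^ j * (var v ^ i * f) + var v ^ i * (var v ^ j * g) = var v ^ (i + j) * (f + g)"
        by (simp add: algebra_simps power_add)
      ultimately show ?thesis
        by metis
    qed
    then show "f + g \<in> S W"
      using fg by (auto simp: S_def add_in_polys)
  next
    fix f g :: "('v, 'k) mpoly" assume "f \<in> polys V" "g \<in> S W"
    have "\<exists>n. var v ^ n * (f * g) \<in> I" if v: "v \<in> W" for v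
    proof -
      obtain n where "var v ^ n * g \<in> I"
        using \<open>g \<in> S W\<close> v unfolding S_def by blast
      then have "f * (var v ^ n * g) \<in> I"
        by (rule ideal_mult[OF I(1) \<open>f \<in> polys V\<close>])
      then show ?thesis
        by (metis mult.left_commute)
    qed
    then show "f * g \<in> S W"
      using \<open>f \<in> polys V\<close> \<open>g \<in> S W\<close> by (auto simp: S_def mult_in_polys)
  qed
  have "W \<subseteq> V \<longrightarrow> mpoly.dim (forms V d :: ('v, 'k) mpoly set) + mpoly.dim (S W \<inter> J \<inter> forms V (d + e)) \<le>
      mpoly.dim (S W \<inter> forms V d) + mpoly.dim (J \<inter> forms V (d + e))" if "finite W" for W
    using that
  proof (induction W rule: finite_induct)
    case empty
    have "S {} = polys V"
      by (auto simp: S_def)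
    moreover have "polys V \<inter> J = J"
      using ideal_subset_polys[OF J(1)] by blast
    moreover have "polys V \<inter> forms V d = (forms V d :: ('v, 'k) mpoly set)"
      by (auto simp: forms_def)
    ultimately show ?case
      by simp
  next
    case (insert v W)
    show ?case
    proof
      assume sub: "insert v W \<subseteq> V"
      obtain A where A: "finite A" "S W \<inter> forms V d \<subseteq> mpoly.span A"
        using finite_span_forms[OF V Int_lower2] .
      obtain C where C: "finite C" "S W \<inter> J \<inter> forms V (d + e) \<subseteq> mpoly.span C"
        using finite_span_forms[OF V Int_lower2] .
      have mono: "S (insert v W) \<subseteq> S W"
        by (auto simp: S_def)
      have "mpoly.dim (S W \<inter> forms V d) + mpoly.dim (S (insert v W) \<inter> J \<inter> forms V (d + e)) \<le>
          mpoly.dim (S (insert v W) \<inter> forms V d) + mpoly.dim (S W \<inter> J \<inter> forms V (d + e))"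
      proof (rule mpoly.dim_add_dim_le[OF linear_mult_mpoly[of "var v ^ e"] _ _ _ _ _ A _ _ C])
        show "(\<lambda>f. var v ^ e * f) ` (S W \<inter> forms V d) \<subseteq> S W \<inter> J \<inter> forms V (d + e)"
        proof clarify
          fix f assume f: "f \<in> S W" "f \<in> forms V d"
          have vV: "var v ^ e \<in> polys V"
            using sub by (intro power_in_polys var_in_polys) auto
          have "var v ^ e * f \<in> S W"
            using ideal_mult[OF iS vV f(1)] sub by simp
          moreover have "var v ^ e * f \<in> J"
            using J(3)[of v] sub f(2) by (intro ideal_mult2[OF J(1)]) (auto simp: forms_def)
          moreover have "var v ^ e * f \<in> forms V (d + e)"
            using vV f(2) homogeneous_mult[OF homogeneous_var_power[of e v], of d f]
            by (auto simp: forms_def add.commute intro: mult_in_polys)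
          ultimately show "var v ^ e * f \<in> S W \<inter> J \<inter> forms V (d + e)"
            by simp
        qed
        fix f assume f: "f \<in> S W \<inter> forms V d" "var v ^ e * f \<in> S (insert v W) \<inter> J \<inter> forms V (d + e)"
        then obtain n where "var v ^ n * (var v ^ e * f) \<in> I"
          by (auto simp: S_def)
        then have "var v ^ (n + e) * f \<in> I"
          by (simp add: power_add mult.assoc)
        then show "f \<in> S (insert v W) \<inter> forms V d"
          using f(1) by (auto simp: S_def)
      next
        have "mpoly.subspace (S (insert v W))" "mpoly.subspace (S W)" "mpoly.subspace J"
          using iS[of W] iS[of "insert v W"] sub J(1) by (auto intro: subspace_ideal)
        then show "mpoly.subspace (S (insert v W) \<inter> forms V d)" "mpoly.subspace (S W \<inter> forms V d)"
          "mpoly.subspace (S (insert v W) \<inter> J \<inter> forms V (d + e))"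
          by (simp_all add: mpoly.subspace_inter subspace_forms)
      qed (use mono in auto)
      then show "mpoly.dim (forms V d :: ('v, 'k) mpoly set) + mpoly.dim (S (insert v W) \<inter> J \<inter> forms V (d + e)) \<le>
          mpoly.dim (S (insert v W) \<inter> forms V d) + mpoly.dim (J \<inter> forms V (d + e))"
        using insert.IH sub by simp
    qed
  qed
  then have "mpoly.dim (forms V d :: ('v, 'k) mpoly set) + mpoly.dim (S V \<inter> J \<inter> forms V (d + e)) \<le>
      mpoly.dim (S V \<inter> forms V d) + mpoly.dim (J \<inter> forms V (d + e))"
    using V by blast
  moreover have "S V = I"
  proof
    show "S V \<subseteq> I"
      using saturated_powers[OF V I] by (auto simp: S_def)
    show "I \<subseteq> S V"
      using ideal_subset_polys[OF I(1)] by (auto simp: S_def intro: exI[of _ 0])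
  qed
  moreover have "I \<inter> J = I"
    using J(2) by blast
  ultimately show ?thesis
    by simp
qed

section \<open>Cactus rank bounds\<close>

lemma cactus_rank_ge:
  fixes F :: "('v::linorder, 'k::field) mpoly"
  assumes V: "finite V" and sq: "\<And>v. v \<in> V \<Longrightarrow> var v ^ 2 \<in> Ann V F"
    and b: "\<And>s. mpoly.dim (Ann V F \<inter> forms V s) + b s \<le> mpoly.dim (forms V s :: ('v, 'k) mpoly set)"
    and K: "2 * K \<le> (\<Sum>s\<le>Suc n. b s)"
  shows "enat K \<le> cactus_rank V F"
  unfolding cactus_rank_def
proof (rule INF_greatest)
  fix I assume "I \<in> {I. closed_subscheme V I \<and> zero_dimensional V I \<and> I \<subseteq> Ann V F}"
  then have I: "closed_subscheme V I" "I \<subseteq> Ann V F"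
    by auto
  then have iI: "ideal I (poly_ring V)" "saturated V I"
    by (auto simp: closed_subscheme_def homogeneous_ideal_def)
  define a where "a s = mpoly.dim (forms V s :: ('v, 'k) mpoly set) - mpoly.dim (I \<inter> forms V s)" for s
  have le: "mpoly.dim (U \<inter> forms V s) \<le> mpoly.dim (W \<inter> forms V s)"
    if UW: "U \<subseteq> W" "ideal U (poly_ring V)" for U W :: "('v, 'k) mpoly set" and s
  proof -
    obtain C where C: "finite C" "W \<inter> forms V s \<subseteq> mpoly.span C"
      using finite_span_forms[OF V Int_lower2] .
    have "card ({} :: ('v, 'k) mpoly set) + mpoly.dim (U \<inter> forms V s) \<le> mpoly.dim (W \<inter> forms V s)"
    proof (rule mpoly.card_add_dim_le_dim[OF _ _ C, where h = "\<lambda>x. x"])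
      show "mpoly.subspace (U \<inter> forms V s)"
        by (intro mpoly.subspace_inter subspace_ideal[OF UW(2)] subspace_forms)
    qed (use UW in auto)
    then show ?thesis
      by simp
  qed
  have forms_polys: "polys V \<inter> forms V s = (forms V s :: ('v, 'k) mpoly set)" for s
    by (auto simp: forms_def)
  have dim_le: "mpoly.dim (I \<inter> forms V s) \<le> mpoly.dim (forms V s :: ('v, 'k) mpoly set)" for s
  proof -
    have "I \<subseteq> polys V"
      using ideal_subset_polys[OF iI(1)] by blast
    then show ?thesis
      using le[OF _ iI(1), of "polys V" s] forms_polys[of s] by simp
  qed
  have step: "a s + b (s + 2) \<le> a (s + 2)" for s
    using dim_ideal_saturation_step[OF V iI ideal_Ann I(2) sq, of s] b[of "s + 2"]
      dim_le[of s] dim_le[of "s + 2"] unfolding a_def by linarith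
  have base: "b s \<le> a s" for s
    using b[of s] le[OF I(2) iI(1), of s] unfolding a_def by linarith
  have sum_le: "(\<Sum>s\<le>Suc m. b s) \<le> a (Suc m) + a m" for m
  proof (induction m)
    case 0
    then show ?case
      using base[of 0] base[of 1] by simp
  next
    case (Suc m)
    then show ?case
      using step[of m] by simp
  qed
  show "enat K \<le> scheme_length V I"
  proof (cases "scheme_length V I")
    case (enat L)
    have aL: "a s \<le> L" for s
      using dim_forms_le_scheme_length[OF V I(1), of s] unfolding a_def enat by simp
    have "2 * K \<le> 2 * L"
      using K sum_le[of n] aL[of "Suc n"] aL[of n] by linarith
    then show ?thesis
      by (simp add: enat)
  qed simp
qed

lemma lookup_var_power_mult: "lookup (var v ^ n * f) (single v n + m) = lookup f m"
  unfolding var_power lookup_single_mult_add by simp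

lemma lookup_var_power_mult_eq_0: "lookup q v < n \<Longrightarrow> lookup (var v ^ n * f) q = 0"
  unfolding var_power by (rule lookup_single_mult_eq_0) (auto simp: lookup_add)

lemma monomial_contract_var_power_mult:
  assumes a': "lookup a' v = 0" and "i \<le> M"
  shows "single (single v i + a') c \<circ>\<^sub>c (var v ^ M * F) = var v ^ (M - i) * (single a' c \<circ>\<^sub>c F)"
proof (rule poly_mapping_eqI)
  fix q
  show "lookup (single (single v i + a') c \<circ>\<^sub>c (var v ^ M * F)) q =
      lookup (var v ^ (M - i) * (single a' c \<circ>\<^sub>c F)) q"
  proof (cases "M - i \<le> lookup q v")
    case True
    define q' where "q' = q - single v (M - i)"
    have q: "q = single v (M - i) + q'"
      unfolding q'_def by (rule monomial_split) (use True in \<open>auto simp: lookup_single when_def\<close>)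
    have "single v i + a' + q = (single v i + single v (M - i)) + (a' + q')"
      unfolding q by (simp add: algebra_simps)
    also have "\<dots> = single v M + (a' + q')"
      using assms(2) by (simp flip: single_add)
    finally show ?thesis
      unfolding lookup_single_contract
      by (subst (2) q) (simp add: lookup_var_power_mult lookup_single_contract)
  next
    case False
    then have "lookup (single v i + a' + q) v < M"
      using a' assms(2) by (simp add: lookup_add)
    then show ?thesis
      using False by (simp add: lookup_single_contract lookup_var_power_mult_eq_0)
  qed
qed

lemma contract_one [simp]: "1 \<circ>\<^sub>c F = F"
  using contract_const[of 1 F] by simp

lemma var_power_contract_var_power_mult:
  "var v ^ i \<circ>\<^sub>c (var v ^ (M + i) * F) = var v ^ M * F"
  using monomial_contract_var_power_mult[of 0 v i "M + i" 1 F]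
  by (simp add: var_power contract_const)

text \<open>
  The ideal of the local Gorenstein scheme at the coordinate point of \<open>v\<close> whose inverse system
  is generated by the dehomogenisation of \<open>F\<close> at \<open>v = 1\<close>.
\<close>

definition cone_ideal :: "'v set \<Rightarrow> 'v \<Rightarrow> ('v, 'k::field) mpoly \<Rightarrow> ('v, 'k) mpoly set" where
  "cone_ideal V v F = (\<Inter>M. Ann V (var v ^ M * F))"

lemma mem_cone_ideal_iff: "f \<in> cone_ideal V v F \<longleftrightarrow> f \<in> polys V \<and> (\<forall>M. f \<circ>\<^sub>c (var v ^ M * F) = 0)"
  by (auto simp: cone_ideal_def Ann_def)

lemma closed_subscheme_cone_ideal:
  assumes F: "homogeneous e F" and v: "v \<in> V"
  shows "closed_subscheme V (cone_ideal V v F)"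
proof -
  have hom: "homogeneous_ideal V (Ann V (var v ^ M * F))" for M
    by (rule homogeneous_ideal_Ann[OF homogeneous_mult[OF homogeneous_var_power F]])
  have "ideal (cone_ideal V v F) (poly_ring V)"
    by (auto simp: ideal_poly_ring_iff mem_cone_ideal_iff contract_add contract_mult
        intro: add_in_polys mult_in_polys)
  moreover have "\<forall>f\<in>cone_ideal V v F. \<forall>d. hom_component d f \<in> cone_ideal V v F"
    using hom by (auto simp: cone_ideal_def homogeneous_ideal_def)
  moreover have "saturated V (cone_ideal V v F)"
    unfolding saturated_def
  proof (intro ballI impI)
    fix f :: "('a, 'b) mpoly"
    assume f: "f \<in> polys V" "\<exists>N. \<forall>g\<in>polys V. homogeneous N g \<longrightarrow> g * f \<in> cone_ideal V v F"
    from f(2) obtain N where N: "\<forall>g\<in>polys V. homogeneous N g \<longrightarrow> g * f \<in> cone_ideal V v F" ..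
    have "var v ^ N * f \<in> cone_ideal V v F"
      by (rule N[rule_format, OF power_in_polys[OF var_in_polys[OF v]] homogeneous_var_power])
    then have "(f * var v ^ N) \<circ>\<^sub>c (var v ^ (M + N) * F) = 0" for M
      by (simp add: mem_cone_ideal_iff mult.commute)
    then show "f \<in> cone_ideal V v F"
      using f(1) by (simp add: mem_cone_ideal_iff contract_mult var_power_contract_var_power_mult)
  qed
  ultimately show ?thesis
    by (simp add: closed_subscheme_def homogeneous_ideal_def)
qed

lemma forms_mem_cone_ideal:
  assumes f: "f \<in> forms V d" and 0: "f \<circ>\<^sub>c (var v ^ d * F) = 0"
  shows "f \<in> cone_ideal V v F"
  unfolding mem_cone_ideal_iff
proof (intro conjI allI)
  show "f \<in> polys V"
    using f by (simp add: forms_def)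
  fix M
  show "f \<circ>\<^sub>c (var v ^ M * F) = 0"
  proof (cases "M \<le> d")
    case True
    then have "f \<circ>\<^sub>c (var v ^ M * F) = (f * var v ^ (d - M)) \<circ>\<^sub>c (var v ^ d * F)"
      using var_power_contract_var_power_mult[of v "d - M" M F] by (simp add: contract_mult)
    also have "\<dots> = var v ^ (d - M) \<circ>\<^sub>c (f \<circ>\<^sub>c (var v ^ d * F))"
      by (simp only: mult.commute[of f] contract_mult)
    finally show ?thesis
      by (simp add: 0)
  next
    case False
    have mon: "single a c \<circ>\<^sub>c (var v ^ M * F) = var v ^ (M - d) * (single a c \<circ>\<^sub>c (var v ^ d * F))"
      if a: "mdeg a = d" for a c
    proof -
      define a' where "a' = a - single v (lookup a v)"
      have a_eq: "a = single v (lookup a v) + a'"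
        unfolding a'_def by (rule monomial_split) (auto simp: lookup_single when_def)
      have "lookup a' v = 0"
        by (simp add: a'_def lookup_minus)
      moreover have "lookup a v \<le> d"
        using a a_eq by (metis le_add1 mdeg_add mdeg_single)
      ultimately have eq: "single a c \<circ>\<^sub>c (var v ^ M' * F) = var v ^ (M' - lookup a v) * (single a' c \<circ>\<^sub>c F)"
        if "M' \<ge> d" for M'
        using monomial_contract_var_power_mult[of a' v "lookup a v" M' c F] a_eq that by auto
      have exps: "M - lookup a v = (M - d) + (d - lookup a v)" "d \<le> M"
        using False \<open>lookup a v \<le> d\<close> by simp_all
      show ?thesis
        by (simp only: eq[OF exps(2)] eq[OF order_refl] exps(1) power_add mult.assoc)
    qed
    have "f \<circ>\<^sub>c (var v ^ M * F) = (\<Sum>a\<in>keys f. single a (lookup f a) \<circ>\<^sub>c (var v ^ M * F))"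
      by (subst (1) poly_mapping_sum_single[of f]) (rule contract_sum)
    also have "\<dots> = (\<Sum>a\<in>keys f. var v ^ (M - d) * (single a (lookup f a) \<circ>\<^sub>c (var v ^ d * F)))"
      using f by (intro sum.cong refl mon) (auto simp: forms_def homogeneous_def)
    also have "\<dots> = var v ^ (M - d) * ((\<Sum>a\<in>keys f. single a (lookup f a)) \<circ>\<^sub>c (var v ^ d * F))"
      by (simp add: sum_distrib_left contract_sum)
    also have "\<dots> = 0"
      unfolding poly_mapping_sum_single[of f, symmetric] by (simp add: 0)
    finally show ?thesis .
  qed
qed

definition coordinate_point :: "'v set \<Rightarrow> 'v \<Rightarrow> ('v, 'k::field) mpoly set" where
  "coordinate_point V v = {f \<in> polys V. \<forall>i. lookup f (single v i) = 0}"

lemma single_eq_addD: "single v n = a + b \<Longrightarrow> \<exists>i. a = single v i" for n :: nat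
proof (intro exI poly_mapping_eqI)
  fix w assume "single v n = a + b"
  then have "lookup (single v n) w = lookup a w + lookup b w"
    by (simp add: lookup_add)
  then show "lookup a w = lookup (single v (lookup a v)) w"
    by (auto simp: lookup_single when_def split: if_splits)
qed

lemma ideal_coordinate_point: "ideal (coordinate_point V v) (poly_ring V)"
  unfolding ideal_poly_ring_iff
proof (intro conjI ballI)
  fix f g :: "('a, 'b) mpoly" assume fg: "f \<in> polys V" "g \<in> coordinate_point V v"
  have "lookup (f * g) (single v i) = 0" for i
  proof (rule ccontr)
    assume "lookup (f * g) (single v i) \<noteq> 0"
    then obtain a b where "single v i = b + a" "b \<in> keys g"
      using keys_mult[of f g] by (auto simp: in_keys_iff add.commute)
    then show False
      using fg(2) single_eq_addD[of v i b a] by (auto simp: coordinate_point_def in_keys_iff)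
  qed
  then show "f * g \<in> coordinate_point V v"
    using fg by (auto simp: coordinate_point_def mult_in_polys)
qed (auto simp: coordinate_point_def lookup_add add_in_polys)

lemma coordinate_point_diff:
  assumes "f \<in> forms V d" "v \<in> V"
  shows "f - single (single v d) (lookup f (single v d)) \<in> coordinate_point V v"
proof -
  have "lookup f (single v i) = 0" if "i \<noteq> d" for i
    using assms(1) that in_keys_iff[of "single v i" f] by (auto simp: forms_def homogeneous_def)
  moreover have "f - single (single v d) (lookup f (single v d)) \<in> polys V"
    using assms single_in_polys[of "single v d" V "- lookup f (single v d)"]
      add_in_polys[of f V "- single (single v d) (lookup f (single v d))"]
    by (auto simp: forms_def single_uminus)
  moreover have "lookup (f - single (single v d) (lookup f (single v d))) (single v i) = 0" for i
    using calculation(1)[of i] by (cases "i = d") (auto simp: lookup_minus lookup_single when_def)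
  ultimately show ?thesis
    by (simp add: coordinate_point_def)
qed

lemma coordinate_point_in_points:
  assumes v: "v \<in> V" and I: "I \<subseteq> coordinate_point V v"
  shows "coordinate_point V v \<in> points V I"
proof -
  let ?P = "coordinate_point V v :: ('a, 'b) mpoly set"
  have P: "ideal ?P (poly_ring V)"
    by (rule ideal_coordinate_point)
  have hom: "homogeneous_ideal V ?P"
    using P by (auto simp: homogeneous_ideal_def coordinate_point_def lookup_hom_component hom_component_in_polys)
  have var_mem: "single (single v d) c \<in> ?P \<longleftrightarrow> c = 0" for d c
    using v by (auto simp: coordinate_point_def lookup_single when_def single_in_polys)
  have "primeideal ?P (poly_ring V)"
  proof (rule primeideal_homogeneousI[OF hom])
    show "1 \<notin> ?P"
      using var_mem[of 0 1] by simp
    fix f g :: "('a, 'b) mpoly" and d e assume fg: "f \<in> forms V d" "g \<in> forms V e" "f * g \<in> ?P"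
    define c y where "c = lookup f (single v d)" and "y = single (single v d) c"
    define c' y' where "c' = lookup g (single v e)" and "y' = single (single v e) c'"
    have fy: "f - y \<in> ?P" and gy: "g - y' \<in> ?P"
      using coordinate_point_diff fg v by (auto simp: c_def y_def c'_def y'_def)
    have yV: "y \<in> polys V"
      using v by (auto simp: y_def polys_def)
    have "y * y' = f * g - (f - y) * g - y * (g - y')"
      by (simp add: algebra_simps)
    also have "\<dots> \<in> ?P"
      using fg(2) yV
      by (intro ideal_diff[OF P] ideal_mult2[OF P fy] ideal_mult[OF P _ gy] fg(3)) (auto simp: forms_def)
    finally have "c * c' = 0"
      using var_mem[of "d + e" "c * c'"] by (simp add: y_def y'_def mult_single flip: single_add)
    then show "f \<in> ?P \<or> g \<in> ?P"
      using fy gy by (auto simp: y_def y'_def)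
  qed
  moreover have "\<not> irrelevant_ideal V \<subseteq> ?P"
    using irrelevant_ideal_subset_iff[OF P] v var_mem[of 1 1] by (auto simp: var_def)
  ultimately show ?thesis
    using hom I by (simp add: points_def)
qed

lemma points_subset_coordinate_point:
  assumes v: "v \<in> V" and I: "\<And>w. w \<in> V - {v} \<Longrightarrow> var w ^ 2 \<in> I"
  shows "points V I \<subseteq> {coordinate_point V v}"
proof
  fix Q assume "Q \<in> points V I"
  then have hQ: "homogeneous_ideal V Q" and iQ: "ideal Q (poly_ring V)" and IQ: "I \<subseteq> Q"
    and irr: "\<not> irrelevant_ideal V \<subseteq> Q" and pQ: "primeideal Q (poly_ring V)"
    and prime: "\<And>f g. f \<in> polys V \<Longrightarrow> g \<in> polys V \<Longrightarrow> f * g \<in> Q \<Longrightarrow> f \<in> Q \<or> g \<in> Q"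
    by (auto simp: points_def homogeneous_ideal_def primeideal_poly_ring_iff)
  have w: "var w \<in> Q" if "w \<in> V - {v}" for w
    using I[OF that] IQ that prime[of "var w" "var w"] var_in_polys[of w V]
    by (auto simp: power2_eq_square)
  then have vQ: "var v \<notin> Q"
    using irr irrelevant_ideal_subset_iff[OF iQ] by blast
  have vpow: "var v ^ n \<notin> Q" for n
    by (rule power_notin_primeideal[OF pQ var_in_polys[OF v] vQ])
  have PQ: "coordinate_point V v \<subseteq> Q"
  proof
    fix f :: "('a, 'b) mpoly" assume f: "f \<in> coordinate_point V v"
    show "f \<in> Q"
    proof (rule ideal_of_monomials[OF iQ])
      fix m assume m: "m \<in> keys f"
      have km: "keys m \<subseteq> V"
        using f m by (auto simp: coordinate_point_def polys_def)
      have "\<not> keys m \<subseteq> {v}"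
      proof
        assume "keys m \<subseteq> {v}"
        then have "m = single v (lookup m v)"
          by (intro poly_mapping_eqI) (auto simp: lookup_single when_def in_keys_iff)
        then have "lookup f m = 0"
          using f unfolding coordinate_point_def by (metis (mono_tags, lifting) mem_Collect_eq)
        then show False
          using m by (simp add: in_keys_iff)
      qed
      then obtain w' where w': "w' \<in> keys m" "w' \<in> V - {v}"
        using km by blast
      then show "single m (lookup f m) \<in> Q"
        using monomial_in_ideal[OF iQ, of w' 1 1 m "lookup f m"] w[OF w'(2)] km by (simp add: in_keys_iff)
    qed
  qed
  moreover have "Q \<subseteq> coordinate_point V v"
  proof
    fix f assume f: "f \<in> Q"
    show "f \<in> coordinate_point V v"
    proof (rule ccontr)
      assume "f \<notin> coordinate_point V v"
      then obtain d where d: "lookup f (single v d) \<noteq> 0"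
        using ideal_subset_polys[OF iQ f] by (auto simp: coordinate_point_def)
      define g where "g = hom_component d f"
      define c where "c = lookup g (single v d)"
      have c: "c \<noteq> 0"
        using d by (simp add: c_def g_def lookup_hom_component)
      have g: "g \<in> Q" "g \<in> forms V d"
        using hQ f ideal_subset_polys[OF iQ f]
        by (auto simp: g_def homogeneous_ideal_def forms_def hom_component_in_polys)
      have "g - (g - single (single v d) c) \<in> Q"
        using coordinate_point_diff[OF g(2) v] PQ by (rule_tac ideal_diff[OF iQ g(1)]) (auto simp: c_def)
      then have "single (single v d) c \<in> Q"
        by simp
      then have "single 0 (inverse c) * single (single v d) c \<in> Q"
        by (rule ideal_mult[OF iQ const_in_polys])
      then show False
        using vpow[of d] c by (simp add: mult_single var_power)
    qed
  qed
  ultimately show "Q \<in> {coordinate_point V v}"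
    by blast
qed

lemma cone_ideal_subset_coordinate_point:
  assumes F: "homogeneous e F" "F \<noteq> 0" and v: "v \<in> V"
  shows "cone_ideal V v F \<subseteq> coordinate_point V v"
proof
  fix f assume f: "f \<in> cone_ideal V v F"
  have fV: "f \<in> polys V"
    using f by (simp add: mem_cone_ideal_iff)
  have "keys F \<noteq> {}"
    using F(2) by (metis in_keys_iff lookup_zero poly_mapping_eqI empty_iff)
  then obtain m where m: "m \<in> keys F" "\<And>q. q \<in> keys F \<Longrightarrow> lookup m v \<le> lookup q v"
    using ex_min_if_finite[of "(\<lambda>q. lookup q v) ` keys F"] finite_keys[of F]
    by (metis (no_types, lifting) finite_imageI image_iff image_is_empty not_le)
  have "lookup f (single v i) = 0" for i
  proof -
    define g where "g = hom_component i f"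
    have "g \<in> cone_ideal V v F"
      using f closed_subscheme_cone_ideal[OF F(1) v]
      by (simp add: g_def closed_subscheme_def homogeneous_ideal_def)
    then have "lookup (g \<circ>\<^sub>c (var v ^ i * F)) m = 0"
      by (simp add: mem_cone_ideal_iff)
    moreover have "lookup (g \<circ>\<^sub>c (var v ^ i * F)) m =
        (\<Sum>a\<in>insert (single v i) (keys g). lookup g a * lookup (var v ^ i * F) (a + m))"
      by (rule lookup_contract_superset) auto
    moreover have "\<dots> = (\<Sum>a\<in>insert (single v i) (keys g).
        if a = single v i then lookup g (single v i) * lookup F m else 0)"
    proof (intro sum.cong refl)
      fix a assume a: "a \<in> insert (single v i) (keys g)"
      show "lookup g a * lookup (var v ^ i * F) (a + m) =
          (if a = single v i then lookup g (single v i) * lookup F m else 0)"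
      proof (cases "a = single v i")
        case True
        then show ?thesis
          by (simp add: lookup_var_power_mult)
      next
        case False
        have deg: "mdeg a = i"
          using a False by (auto simp: g_def keys_hom_component)
        have av: "lookup a v < i"
        proof (rule ccontr)
          assume "\<not> lookup a v < i"
          then have "a = single v i + (a - single v i)"
            by (intro monomial_split) (auto simp: lookup_single when_def)
          then have "mdeg (a - single v i) = 0"
            using deg by (metis add_cancel_left_right mdeg_add mdeg_single)
          then have "a - single v i = 0"
            by (intro poly_mapping_eqI) (auto simp: mdeg_def in_keys_iff)
          then show False
            using \<open>a = single v i + (a - single v i)\<close> False by simp
        qed
        have "lookup (var v ^ i * F) (a + m) = 0"
        proof (rule ccontr)
          assume nz: "lookup (var v ^ i * F) (a + m) \<noteq> 0"
          then have ge: "i \<le> lookup (a + m) v"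
            using lookup_var_power_mult_eq_0[of "a + m" v i F] by (meson not_le)
          define q where "q = a + m - single v i"
          have q: "a + m = single v i + q"
            unfolding q_def by (rule monomial_split) (use ge in \<open>auto simp: lookup_single when_def\<close>)
          then have "q \<in> keys F"
            using nz by (simp add: lookup_var_power_mult in_keys_iff)
          moreover have "lookup a v + lookup m v = i + lookup q v"
            using q by (metis lookup_add lookup_single_eq)
          ultimately show False
            using m(2)[of q] av by simp
        qed
        then show ?thesis
          using False by simp
      qed
    qed
    moreover have "\<dots> = lookup g (single v i) * lookup F m"
      by simp
    ultimately have "lookup g (single v i) * lookup F m = 0"
      by simp
    then show ?thesis
      using m(1) by (simp add: in_keys_iff g_def lookup_hom_component)
  qed
  then show "f \<in> coordinate_point V v"
    using fV by (simp add: coordinate_point_def)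
qed

lemma quotient_dim_le:
  fixes I :: "('v::linorder, 'k::field) mpoly set"
  assumes V: "finite V" and I: "ideal I (poly_ring V)" and P: "primeideal P (poly_ring V)"
    and N: "\<And>d. mpoly.dim (forms V d :: ('v, 'k) mpoly set) \<le> mpoly.dim (I \<inter> forms V d) + N"
  shows "quotient_dim (local_ring V P) (ideal_stalk V I P) \<le> enat N"
  unfolding quotient_dim_def
proof (rule SUP_least)
  fix B assume "B \<in> {B. finite B \<and> B \<subseteq> local_ring V P \<and> independent_mod (ideal_stalk V I P) B}"
  then have B: "finite B" "B \<subseteq> local_ring V P" "independent_mod (ideal_stalk V I P) B"
    by auto
  have iP: "ideal P (poly_ring V)" "P \<noteq> polys V"
    and prime: "\<And>f g. f \<in> polys V \<Longrightarrow> g \<in> polys V \<Longrightarrow> f * g \<in> P \<Longrightarrow> f \<in> P \<or> g \<in> P"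
    using P by (auto simp: primeideal_poly_ring_iff)
  have one: "1 \<notin> P"
    by (rule one_notin_primeideal[OF P])
  have "\<forall>b\<in>B. \<exists>f g d. b = Fract f g \<and> f \<in> polys V \<and> g \<in> polys V - P \<and> homogeneous d f \<and> homogeneous d g"
    using B(2) unfolding local_ring_def by blast
  then obtain num den deg where nd: "\<And>b. b \<in> B \<Longrightarrow> b = Fract (num b) (den b) \<and> num b \<in> polys V \<and>
      den b \<in> polys V - P \<and> homogeneous (deg b) (num b) \<and> homogeneous (deg b) (den b)"
    by metis
  have prod_den: "prod den A \<in> polys V - P \<and> homogeneous (sum deg A) (prod den A)" if "A \<subseteq> B" for A
    using finite_subset[OF that B(1)] that
  proof (induction A rule: finite_induct)
    case empty
    then show ?case
      using one by (simp add: homogeneous_def)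
  next
    case (insert b A)
    then show ?case
      using nd[of b] prime[of "den b" "prod den A"] by (auto intro: mult_in_polys homogeneous_mult)
  qed
  define g d where "g = prod den B" and "d = sum deg B"
  define h where "h b = num b * prod den (B - {b})" for b
  have g: "g \<in> polys V" "g \<notin> P" "homogeneous d g"
    using prod_den[of B] by (auto simp: g_def d_def)
  have g0: "g \<noteq> 0"
    using g(2) ideal_zero[OF iP(1)] by blast
  have h: "h b \<in> forms V d" "b = Fract (h b) g" if b: "b \<in> B" for b
  proof -
    have "d = deg b + sum deg (B - {b})" "g = den b * prod den (B - {b})"
      using sum.remove[OF B(1) b] prod.remove[OF B(1) b] by (auto simp: d_def g_def)
    moreover have "prod den (B - {b}) \<noteq> 0"
      using prod_den[of "B - {b}"] ideal_zero[OF iP(1)] by auto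
    ultimately show "h b \<in> forms V d" "b = Fract (h b) g"
      using nd[OF b] prod_den[of "B - {b}"]
      by (auto simp: forms_def h_def mult_fract_cancel intro: mult_in_polys homogeneous_mult)
        (metis mult.commute mult_fract_cancel)
  qed
  obtain C where C: "finite C" "forms V d \<subseteq> mpoly.span (C :: ('v, 'k) mpoly set)"
    using finite_span_forms[OF V subset_refl] .
  have "card B + mpoly.dim (I \<inter> forms V d) \<le> mpoly.dim (forms V d :: ('v, 'k) mpoly set)"
  proof (rule mpoly.card_add_dim_le_dim[OF _ Int_lower2 C B(1), of I h])
    show "mpoly.subspace (I \<inter> forms V d)"
      by (intro mpoly.subspace_inter subspace_ideal[OF I] subspace_forms)
    show "h ` B \<subseteq> forms V d"
      using h(1) by blast
    fix c assume c: "(\<Sum>b\<in>B. single 0 (c b) * h b) \<in> I \<inter> forms V d"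
    have "(\<Sum>b\<in>B. scalar (c b) * b) = (\<Sum>b\<in>B. Fract (single 0 (c b) * h b) g)"
      by (intro sum.cong refl) (metis h(2) scalar_mult_Fract)
    also have "\<dots> = Fract (\<Sum>b\<in>B. single 0 (c b) * h b) g"
      by (rule sum_Fract[OF g0])
    also have "\<dots> \<in> ideal_stalk V I P"
      using c g unfolding ideal_stalk_def forms_def by blast
    finally show "\<forall>b\<in>B. c b = 0"
      using B(3) unfolding independent_mod_def by blast
  qed
  then show "enat (card B) \<le> enat N"
    using N[of d] by simp
qed

lemma cactus_rank_le:
  fixes F :: "('v::linorder, 'k::field) mpoly"
  assumes V: "finite V" "v \<in> V" and F: "homogeneous e F" "F \<noteq> 0"
    and sq: "\<And>w. w \<in> V - {v} \<Longrightarrow> var w ^ 2 \<in> Ann V F"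
    and G: "\<And>d. finite (G d)" "\<And>d. card (G d) \<le> N"
      "\<And>d a. a \<in> monomials V d \<Longrightarrow> single a 1 \<circ>\<^sub>c (var v ^ d * F) \<in> mpoly.span (G d)"
  shows "cactus_rank V F \<le> enat N"
proof -
  let ?I = "cone_ideal V v F" and ?P = "coordinate_point V v :: ('v, 'k) mpoly set"
  have I: "closed_subscheme V ?I"
    by (rule closed_subscheme_cone_ideal[OF F(1) V(2)])
  then have iI: "ideal ?I (poly_ring V)"
    by (simp add: closed_subscheme_def homogeneous_ideal_def)
  have "var w ^ 2 \<in> ?I" if w: "w \<in> V - {v}" for w
    unfolding mem_cone_ideal_iff
  proof (intro conjI allI)
    show "var w ^ 2 \<in> polys V"
      using w by (intro power_in_polys var_in_polys) auto
    fix M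
    have "single (single v 0 + single w 2) 1 \<circ>\<^sub>c (var v ^ M * F) = var v ^ (M - 0) * (single (single w 2) 1 \<circ>\<^sub>c F)"
      using w by (intro monomial_contract_var_power_mult) (auto simp: lookup_single when_def)
    moreover have "single (single w 2) 1 \<circ>\<^sub>c F = 0"
      using sq[OF w] by (simp add: Ann_def var_power)
    ultimately show "var w ^ 2 \<circ>\<^sub>c (var v ^ M * F) = 0"
      by (simp add: var_power)
  qed
  then have "points V ?I \<subseteq> {?P}"
    by (rule points_subset_coordinate_point[OF V(2)])
  moreover have P: "?P \<in> points V ?I"
    by (rule coordinate_point_in_points[OF V(2) cone_ideal_subset_coordinate_point[OF F V(2)]])
  ultimately have pts: "points V ?I = {?P}"
    by blast
  have "?I \<subseteq> Ann V F"
    unfolding cone_ideal_def by (rule INF_lower2[of 0]) auto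
  moreover have "zero_dimensional V ?I"
    unfolding zero_dimensional_def pts by auto
  ultimately have "cactus_rank V F \<le> scheme_length V ?I"
    unfolding cactus_rank_def using I by (intro INF_lower) auto
  also have "scheme_length V ?I \<le> quotient_dim (local_ring V ?P) (ideal_stalk V ?I ?P)"
    unfolding scheme_length_def pts by (rule SUP_least) (auto simp: subset_singleton_iff)
  also have "\<dots> \<le> enat N"
  proof (rule quotient_dim_le[OF V(1) iI])
    show "primeideal ?P (poly_ring V)"
      using P by (simp add: points_def)
    fix d
    obtain C where C: "finite C" "forms V d \<subseteq> mpoly.span (C :: ('v, 'k) mpoly set)"
      using finite_span_forms[OF V(1) subset_refl] .
    have "mpoly.dim (forms V d :: ('v, 'k) mpoly set) + mpoly.dim {0 :: ('v, 'k) mpoly} \<le>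
        mpoly.dim (?I \<inter> forms V d) + mpoly.dim (mpoly.span (G d))"
    proof (rule mpoly.dim_add_dim_le[OF linear_contract[of "var v ^ d * F"] _ _ _ _ _ C _ _ G(1)])
      show "(\<lambda>f. f \<circ>\<^sub>c (var v ^ d * F)) ` forms V d \<subseteq> mpoly.span (G d)"
      proof clarify
        fix f :: "('v, 'k) mpoly" assume f: "f \<in> forms V d"
        have "f \<circ>\<^sub>c (var v ^ d * F) = (\<Sum>a\<in>keys f. single 0 (lookup f a) * single a 1) \<circ>\<^sub>c (var v ^ d * F)"
          by (subst (1) poly_mapping_sum_single[of f]) (simp add: mult_single)
        also have "\<dots> = (\<Sum>a\<in>keys f. single 0 (lookup f a) * (single a 1 \<circ>\<^sub>c (var v ^ d * F)))"
          unfolding contract_sum contract_mult contract_const ..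
        also have "\<dots> \<in> mpoly.span (G d)"
          using f by (intro mpoly.span_sum mpoly.span_scale G(3))
            (auto simp: forms_def monomials_def polys_def homogeneous_def)
        finally show "f \<circ>\<^sub>c (var v ^ d * F) \<in> mpoly.span (G d)" .
      qed
      show "mpoly.subspace (?I \<inter> forms V d)"
        by (intro mpoly.subspace_inter subspace_ideal[OF iI] subspace_forms)
      show "f \<in> ?I \<inter> forms V d" if "f \<in> forms V d" "f \<circ>\<^sub>c (var v ^ d * F) \<in> {0}" for f
        using forms_mem_cone_ideal[of f V d v F] that by simp
    qed (auto simp: subspace_forms mpoly.span_zero)
    moreover have "mpoly.dim (mpoly.span (G d)) \<le> N"
      using mpoly.dim_le_card[of "mpoly.span (G d)" "G d"] G(1,2)[of d] by simp
    ultimately show "mpoly.dim (forms V d :: ('v, 'k) mpoly set) \<le> mpoly.dim (?I \<inter> forms V d) + N"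
      by simp
  qed
  finally show ?thesis .
qed

section \<open>Matchings and permutations\<close>

definition verts :: "('a \<times> 'a) set \<Rightarrow> 'a set" where
  "verts E = (\<Union>e\<in>E. {fst e, snd e})"

definition perfect_matching :: "'a::linorder set \<Rightarrow> ('a \<times> 'a) set \<Rightarrow> bool" where
  "perfect_matching T E \<longleftrightarrow> (\<forall>e\<in>E. fst e < snd e) \<and>
     (\<forall>e\<in>E. \<forall>e'\<in>E. e \<noteq> e' \<longrightarrow> {fst e, snd e} \<inter> {fst e', snd e'} = {}) \<and> verts E = T"

lemma perfect_matching_edgeD:
  "perfect_matching T E \<Longrightarrow> e \<in> E \<Longrightarrow> fst e < snd e \<and> fst e \<in> T \<and> snd e \<in> T"
  by (auto simp: perfect_matching_def verts_def)

lemma perfect_matching_disjointD: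
  "perfect_matching T E \<Longrightarrow> e \<in> E \<Longrightarrow> e' \<in> E \<Longrightarrow> x \<in> {fst e, snd e} \<Longrightarrow> x \<in> {fst e', snd e'} \<Longrightarrow> e = e'"
  unfolding perfect_matching_def by blast

lemma perfect_matching_finite: "perfect_matching T E \<Longrightarrow> finite T \<Longrightarrow> finite E"
  by (rule finite_subset[of E "T \<times> T"]) (auto dest: perfect_matching_edgeD)

lemma perfect_matching_subset:
  "perfect_matching T E \<Longrightarrow> E' \<subseteq> E \<Longrightarrow> perfect_matching (verts E') E'"
  unfolding perfect_matching_def by blast

lemma perfect_matching_Diff:
  assumes "perfect_matching T E" "E' \<subseteq> E"
  shows "perfect_matching (T - verts E') (E - E')"
proof -
  have "verts E = T"
    using assms(1) by (simp add: perfect_matching_def)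
  moreover have "verts (E - E') \<inter> verts E' = {}"
    using perfect_matching_disjointD[OF assms(1)] assms(2) unfolding verts_def by blast
  moreover have "verts E = verts (E - E') \<union> verts E'"
    using assms(2) unfolding verts_def by blast
  ultimately have "verts (E - E') = T - verts E'"
    by blast
  then show ?thesis
    using perfect_matching_subset[OF assms(1), of "E - E'"] by simp
qed

lemma perfect_matching_Un:
  assumes "perfect_matching T E" "perfect_matching T' E'" "T \<inter> T' = {}"
  shows "perfect_matching (T \<union> T') (E \<union> E')"
proof -
  have verts: "verts E = T" "verts E' = T'"
    using assms by (simp_all add: perfect_matching_def)
  then have "verts (E \<union> E') = T \<union> T'"
    unfolding verts_def by blast
  moreover have disj: "{fst e, snd e} \<inter> {fst e', snd e'} = {}" if "e \<in> E" "e' \<in> E'" for e e'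
    using that verts assms(3) unfolding verts_def by blast
  moreover have "{fst e, snd e} \<inter> {fst e', snd e'} = {}" if "e \<in> E'" "e' \<in> E" for e e'
    using disj[OF that(2,1)] by blast
  ultimately show ?thesis
    using assms(1,2) unfolding perfect_matching_def ball_Un by meson
qed

lemma perfect_matching_card:
  assumes E: "perfect_matching T E" and "finite T"
  shows "card T = 2 * card E"
proof -
  have "card T = card (\<Union>e\<in>E. {fst e, snd e})"
    using E by (simp add: perfect_matching_def verts_def)
  also have "\<dots> = (\<Sum>e\<in>E. card {fst e, snd e})"
    using E perfect_matching_finite[OF assms]
    by (intro card_UN_disjoint) (auto simp: perfect_matching_def)
  also have "\<dots> = (\<Sum>e\<in>E. 2)"
  proof (intro sum.cong refl)
    fix e assume "e \<in> E"
    then have "fst e \<noteq> snd e"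
      using perfect_matching_edgeD[OF E] by fastforce
    then show "card {fst e, snd e} = 2"
      by simp
  qed
  finally show ?thesis
    by simp
qed

lemma perfect_matching_exists:
  fixes T :: "'a::linorder set"
  assumes "finite T" "even (card T)"
  shows "\<exists>E. perfect_matching T E"
  using assms
proof (induction "card T" arbitrary: T rule: less_induct)
  case less
  show ?case
  proof (cases "T = {}")
    case True
    then have "perfect_matching T {}"
      by (simp add: perfect_matching_def verts_def)
    then show ?thesis ..
  next
    case False
    then obtain x where x: "x \<in> T"
      by blast
    have "T \<noteq> {x}"
      using less.prems by auto
    then obtain y where y: "y \<in> T" "y \<noteq> x"
      using x by blast
    let ?T = "T - {x, y}"
    have card: "card T = card ?T + 2"
      using x y less.prems(1) card_Diff_subset[of "{x, y}" T] card_mono[of T "{x, y}"] by simp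
    then have "even (card ?T)"
      using less.prems(2) by simp
    then obtain E where E: "perfect_matching ?T E"
      using less.hyps[of ?T] less.prems(1) card by auto
    have "perfect_matching {x, y} {(min x y, max x y)}"
      using y by (auto simp: perfect_matching_def verts_def min_def max_def)
    then have "perfect_matching (?T \<union> {x, y}) (E \<union> {(min x y, max x y)})"
      by (intro perfect_matching_Un[OF E]) auto
    moreover have "?T \<union> {x, y} = T"
      using x y by blast
    ultimately show ?thesis
      by auto
  qed
qed

definition edge_monomial :: "('a \<times> 'a) set \<Rightarrow> ('a \<times> 'a \<Rightarrow>\<^sub>0 nat)" where
  "edge_monomial E = (\<Sum>e\<in>E. single e 1)"

lemma lookup_edge_monomial: "finite E \<Longrightarrow> lookup (edge_monomial E) e = (if e \<in> E then 1 else 0)"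
  by (simp add: edge_monomial_def lookup_sum lookup_single when_def)

lemma keys_edge_monomial [simp]: "finite E \<Longrightarrow> keys (edge_monomial E) = E"
  by (auto simp: in_keys_iff lookup_edge_monomial split: if_splits)

lemma edge_monomial_Un:
  "finite E \<Longrightarrow> finite E' \<Longrightarrow> E \<inter> E' = {} \<Longrightarrow> edge_monomial (E \<union> E') = edge_monomial E + edge_monomial E'"
  by (simp add: edge_monomial_def sum.union_disjoint)

lemma mdeg_edge_monomial: "finite E \<Longrightarrow> mdeg (edge_monomial E) = card E"
  by (simp add: mdeg_def lookup_edge_monomial)

lemma edge_monomial_eq_addD:
  assumes "finite E" "a + b = edge_monomial E"
  shows "keys a \<subseteq> E" "a = edge_monomial (keys a)" "b = edge_monomial (E - keys a)"
proof -
  have sum: "lookup a e + lookup b e = (if e \<in> E then 1 else 0)" for e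
    using assms by (metis lookup_add lookup_edge_monomial)
  then show sub: "keys a \<subseteq> E"
    by (metis add_is_0 in_keys_iff subsetI)
  show a: "a = edge_monomial (keys a)"
  proof (rule poly_mapping_eqI)
    fix e
    show "lookup a e = lookup (edge_monomial (keys a)) e"
      using sum[of e] by (auto simp: lookup_edge_monomial in_keys_iff split: if_splits)
  qed
  show "b = edge_monomial (E - keys a)"
  proof (rule poly_mapping_eqI)
    fix e
    show "lookup b e = lookup (edge_monomial (E - keys a)) e"
      using sum[of e] assms(1) by (auto simp: lookup_edge_monomial in_keys_iff split: if_splits)
  qed
qed

lemma sign_block_permutation:
  assumes "\<pi> permutes {1..n::nat}"
  defines "p \<equiv> \<lambda>\<pi> x. if odd x then 2 * \<pi> ((x + 1) div 2) - 1 else 2 * \<pi> (x div 2)"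
  shows "p \<pi> permutes {1..2 * n} \<and> sign (p \<pi>) = 1"
  using assms(1) finite_atLeastAtMost
proof (induction \<pi> rule: permutes_induct)
  case id
  have "p id = id"
    by (auto simp: p_def fun_eq_iff elim!: oddE)
  then show ?case
    using permutes_id[of "{1..2 * n}"] sign_id by metis
next
  case (swap a b \<pi>)
  let ?s = "transpose (2 * a - 1) (2 * b - 1)" and ?t = "transpose (2 * a) (2 * b)"
  have ab: "a \<ge> 1" "b \<ge> 1" "a \<le> n" "b \<le> n"
    using swap by auto
  have pos: "\<pi> y \<ge> 1" if "y \<ge> 1" for y
    using that permutes_in_image[OF swap.hyps(4), of y] permutes_not_in[OF swap.hyps(4), of y]
    by (cases "y \<in> {1..n}") auto
  have eq: "p (transpose a b \<circ> \<pi>) = ?s \<circ> (?t \<circ> p \<pi>)"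
  proof
    fix x
    show "p (transpose a b \<circ> \<pi>) x = (?s \<circ> (?t \<circ> p \<pi>)) x"
    proof (cases "odd x")
      case True
      define y where "y = \<pi> ((x + 1) div 2)"
      have px: "p \<pi> x = 2 * y - 1" "p (transpose a b \<circ> \<pi>) x = 2 * transpose a b y - 1"
        using True by (simp_all add: p_def y_def)
      have "y \<ge> 1"
        unfolding y_def using True by (intro pos) (auto elim!: oddE)
      then have "?t (2 * y - 1) = 2 * y - 1"
        using ab by (intro transpose_apply_other) presburger+
      moreover have "?s (2 * y - 1) = 2 * transpose a b y - 1"
      proof (cases "y = a \<or> y = b")
        case True
        then show ?thesis
          by (elim disjE) simp_all
      next
        case False
        then have "2 * y - 1 \<noteq> 2 * a - 1" "2 * y - 1 \<noteq> 2 * b - 1"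
          using ab \<open>y \<ge> 1\<close> by presburger+
        then show ?thesis
          using False by (simp add: transpose_apply_other)
      qed
      ultimately show ?thesis
        by (simp only: px comp_apply)
    next
      case False
      define y where "y = \<pi> (x div 2)"
      have px: "p \<pi> x = 2 * y" "p (transpose a b \<circ> \<pi>) x = 2 * transpose a b y"
        using False by (simp_all add: p_def y_def)
      have "?t (2 * y) = 2 * transpose a b y"
        by (cases "y = a \<or> y = b") (elim disjE, simp_all add: transpose_apply_other)
      moreover have "?s (2 * z) = 2 * z" for z
        using ab by (intro transpose_apply_other) presburger+
      ultimately show ?thesis
        by (simp only: px comp_apply)
    qed
  qed
  have s: "?s permutes {1..2 * n}" "?t permutes {1..2 * n}"
    using ab by (auto intro!: permutes_swap_id)
  have "2 * a - 1 \<noteq> 2 * b - 1" "2 * a \<noteq> 2 * b"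
    using ab \<open>a \<noteq> b\<close> by presburger+
  then have sign_st: "sign ?s = - 1" "sign ?t = - 1"
    by (simp_all add: sign_swap_id)
  have perm: "permutation ?s" "permutation ?t" "permutation (p \<pi>)"
    using s swap.IH permutation_permutes by blast+
  have "sign (?s \<circ> (?t \<circ> p \<pi>)) = 1"
    using swap.IH perm sign_st by (simp add: sign_compose permutation_compose)
  moreover have "?s \<circ> (?t \<circ> p \<pi>) permutes {1..2 * n}"
    using s swap.IH by (intro permutes_compose) auto
  ultimately show ?case
    unfolding eq by blast
qed

definition edge :: "(nat \<Rightarrow> nat) \<Rightarrow> nat \<Rightarrow> nat \<times> nat" where
  "edge \<sigma> i = (\<sigma> (2 * i - 1), \<sigma> (2 * i))"

lemma inj_on_edge:
  assumes "\<sigma> permutes A"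
  shows "inj_on (edge \<sigma>) B"
proof (rule inj_onI)
  fix i j assume "edge \<sigma> i = edge \<sigma> j"
  then have "\<sigma> (2 * i) = \<sigma> (2 * j)"
    by (simp add: edge_def)
  then have "2 * i = 2 * j"
    by (rule injD[OF permutes_inj[OF assms]])
  then show "i = j"
    by simp
qed

lemma sign_eq_of_edges_eq:
  assumes p: "p permutes {1..2 * n}" and q: "q permutes {1..2 * n}"
    and eq: "edge p ` {1..n} = edge q ` {1..n}"
  shows "sign p = sign q"
proof -
  let ?A = "{1..n}"
  define \<pi> where "\<pi> i = (if i \<in> ?A then inv_into ?A (edge q) (edge p i) else i)" for i
  have "bij_betw (edge p) ?A (edge q ` ?A)"
    using inj_on_edge[OF p, of ?A] eq by (simp add: bij_betw_def)
  moreover have bq: "bij_betw (edge q) ?A (edge q ` ?A)"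
    using inj_on_edge[OF q] by (simp add: bij_betw_def)
  ultimately have "bij_betw (inv_into ?A (edge q) \<circ> edge p) ?A ?A"
    using bij_betw_trans bij_betw_inv_into by blast
  moreover have "bij_betw \<pi> ?A ?A \<longleftrightarrow> bij_betw (inv_into ?A (edge q) \<circ> edge p) ?A ?A"
    by (rule bij_betw_cong) (simp add: \<pi>_def)
  ultimately have "bij_betw \<pi> ?A ?A"
    by simp
  then have perm: "\<pi> permutes ?A"
    by (rule bij_imp_permutes) (auto simp: \<pi>_def)
  have edge_\<pi>: "edge p i = edge q (\<pi> i)" if "i \<in> ?A" for i
  proof -
    have "edge p i \<in> edge q ` ?A"
      using that eq by blast
    then show ?thesis
      using that f_inv_into_f[of "edge p i" "edge q" ?A] by (simp only: \<pi>_def if_True)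
  qed
  define r where "r x = (if odd x then 2 * \<pi> ((x + 1) div 2) - 1 else 2 * \<pi> (x div 2))" for x
  have r: "r permutes {1..2 * n}" "sign r = 1"
    using sign_block_permutation[OF perm] by (simp_all add: r_def[abs_def])
  have "p x = q (r x)" for x
  proof (cases "x \<in> {1..2 * n}")
    case True
    show ?thesis
    proof (cases "odd x")
      case odd: True
      then have "(x + 1) div 2 \<in> ?A" "2 * ((x + 1) div 2) - 1 = x"
        using True by (auto elim!: oddE)
      then show ?thesis
        using edge_\<pi>[of "(x + 1) div 2"] odd by (simp add: edge_def r_def)
    next
      case False
      then have "x div 2 \<in> ?A" "2 * (x div 2) = x"
        using True by auto
      then show ?thesis
        using edge_\<pi>[of "x div 2"] False by (simp add: edge_def r_def)
    qed
  next
    case False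
    then show ?thesis
      using permutes_not_in[OF p False] permutes_not_in[OF q False] permutes_not_in[OF r(1) False] by simp
  qed
  then have "p = q \<circ> r"
    by auto
  then show ?thesis
    using r p q by (metis finite_atLeastAtMost mult.right_neutral permutation_permutes sign_compose)
qed

lemma perfect_matching_edges:
  assumes \<sigma>: "\<sigma> permutes {1..2 * n}" and lt: "\<And>i. i \<in> {1..n} \<Longrightarrow> \<sigma> (2 * i - 1) < \<sigma> (2 * i)"
  shows "perfect_matching {1..2 * n} (edge \<sigma> ` {1..n})"
proof -
  have inj: "\<sigma> x = \<sigma> y \<longleftrightarrow> x = y" for x y
    using permutes_inj[OF \<sigma>] by (auto dest: injD)
  have "verts (edge \<sigma> ` {1..n}) = \<sigma> ` (\<Union>i\<in>{1..n}. {2 * i - 1, 2 * i})"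
    by (auto simp: verts_def edge_def)
  also have "(\<Union>i\<in>{1..n}. {2 * i - 1, 2 * i}) = {1..2 * n}"
  proof
    show "{1..2 * n} \<subseteq> (\<Union>i\<in>{1..n}. {2 * i - 1, 2 * i})"
    proof
      fix x assume "x \<in> {1..2 * n}"
      then have "(x + 1) div 2 \<in> {1..n}" "x \<in> {2 * ((x + 1) div 2) - 1, 2 * ((x + 1) div 2)}"
        by auto
      then show "x \<in> (\<Union>i\<in>{1..n}. {2 * i - 1, 2 * i})"
        by blast
    qed
  qed auto
  also have "\<sigma> ` {1..2 * n} = {1..2 * n}"
    by (rule permutes_image[OF \<sigma>])
  finally have verts: "verts (edge \<sigma> ` {1..n}) = {1..2 * n}" .
  have disj: "{fst (edge \<sigma> i), snd (edge \<sigma> i)} \<inter> {fst (edge \<sigma> j), snd (edge \<sigma> j)} = {}"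
    if "i \<in> {1..n}" "j \<in> {1..n}" "i \<noteq> j" for i j
    using that by (simp add: edge_def inj) presburger
  show ?thesis
    unfolding perfect_matching_def
  proof (intro conjI ballI impI)
    fix e assume "e \<in> edge \<sigma> ` {1..n}"
    then show "fst e < snd e"
      using lt by (auto simp: edge_def)
  next
    fix e e' assume e: "e \<in> edge \<sigma> ` {1..n}" "e' \<in> edge \<sigma> ` {1..n}" "e \<noteq> e'"
    obtain i where i: "i \<in> {1..n}" "e = edge \<sigma> i"
      using e(1) by (elim imageE)
    obtain j where j: "j \<in> {1..n}" "e' = edge \<sigma> j"
      using e(2) by (elim imageE)
    have "i \<noteq> j"
      using e(3) i(2) j(2) by blast
    then show "{fst e, snd e} \<inter> {fst e', snd e'} = {}"
      unfolding i(2) j(2) by (rule disj[OF i(1) j(1)])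
  qed (rule verts)
qed

lemma pfaffian_perms_edges:
  "\<sigma> \<in> pfaffian_perms n \<Longrightarrow> perfect_matching {1..2 * n} (edge \<sigma> ` {1..n})"
  by (rule perfect_matching_edges) (auto simp: pfaffian_perms_def)

lemma sorted_list_of_edges:
  assumes "\<sigma> \<in> pfaffian_perms n"
  shows "sorted_list_of_set (edge \<sigma> ` {1..n}) = map (edge \<sigma>) [1..<n + 1]"
proof -
  have step: "\<sigma> (2 * i - 1) < \<sigma> (2 * Suc i - 1)" if "1 \<le> i" "i < n" for i
    using assms that by (auto simp: pfaffian_perms_def)
  have mono: "\<sigma> (2 * i - 1) < \<sigma> (2 * j - 1)" if "1 \<le> i" "i < j" "j \<le> n" for i j
    using that
  proof (induction j)
    case (Suc j)
    then show ?case
      using step[of j] by (cases "i = j") auto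
  qed simp
  have "edge \<sigma> i < edge \<sigma> j" if "1 \<le> i" "i < j" "j \<le> n" for i j
    using mono[OF that] by (simp add: edge_def)
  then have "sorted_wrt (<) (map (edge \<sigma>) [1..<n + 1])"
    unfolding sorted_wrt_map by (intro sorted_wrt_mono_rel[OF _ sorted_wrt_upt]) (auto simp del: upt_Suc)
  moreover have "set (map (edge \<sigma>) [1..<n + 1]) = edge \<sigma> ` {1..n}"
    by (simp add: atLeastLessThanSuc_atLeastAtMost del: upt_Suc)
  ultimately show ?thesis
    by (metis sorted_list_of_set.idem_if_sorted_distinct strict_sorted_iff)
qed

lemma pfaffian_perms_eqI:
  assumes "\<sigma> \<in> pfaffian_perms n" "\<tau> \<in> pfaffian_perms n" "edge \<sigma> ` {1..n} = edge \<tau> ` {1..n}"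
  shows "\<sigma> = \<tau>"
proof
  fix x
  have eq: "edge \<sigma> i = edge \<tau> i" if "i \<in> {1..n}" for i
  proof -
    have "map (edge \<sigma>) [1..<n + 1] = map (edge \<tau>) [1..<n + 1]"
      by (rule trans[OF sorted_list_of_edges[OF assms(1), unfolded assms(3), symmetric]
            sorted_list_of_edges[OF assms(2)]])
    then show ?thesis
      using that by (simp add: map_eq_conv del: upt_Suc)
  qed
  show "\<sigma> x = \<tau> x"
  proof (cases "x \<in> {1..2 * n}")
    case True
    then have i: "(x + 1) div 2 \<in> {1..n}"
      by auto
    show ?thesis
    proof (cases "odd x")
      case True
      then have "2 * ((x + 1) div 2) - 1 = x"
        by (auto elim!: oddE)
      then show ?thesis
        using eq[OF i] by (simp add: edge_def)
    next
      case False
      then have "2 * ((x + 1) div 2) = x"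
        by auto
      then show ?thesis
        using eq[OF i] by (simp add: edge_def)
    qed
  next
    case False
    then show ?thesis
      using assms(1,2) permutes_not_in[of \<sigma>, OF _ False] permutes_not_in[of \<tau>, OF _ False]
      by (simp add: pfaffian_perms_def)
  qed
qed

lemma pfaffian_perms_exists:
  assumes E: "perfect_matching {1..2 * n} E"
  shows "\<exists>\<sigma>\<in>pfaffian_perms n. edge \<sigma> ` {1..n} = E"
proof -
  have fin: "finite E"
    using perfect_matching_finite[OF E] by simp
  have card: "card E = n"
    using perfect_matching_card[OF E] by simp
  define es where "es = sorted_list_of_set E"
  have es: "set es = E" "length es = n" "sorted_wrt (<) es" "distinct es"
    using fin card by (simp_all add: es_def)
  define \<sigma> where "\<sigma> x = (if x \<in> {1..2 * n} then
      (if odd x then fst (es ! ((x - 1) div 2)) else snd (es ! ((x - 1) div 2))) else x)" for x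
  have edge: "edge \<sigma> i = es ! (i - 1)" if "i \<in> {1..n}" for i
  proof -
    have "2 * i - 1 \<in> {1..2 * n}" "2 * i \<in> {1..2 * n}" "odd (2 * i - 1)" "even (2 * i)"
      "(2 * i - 1 - 1) div 2 = i - 1" "(2 * i - 1) div 2 = i - 1"
      using that by auto
    then show ?thesis
      by (simp add: edge_def \<sigma>_def)
  qed
  have img: "edge \<sigma> ` {1..n} = E"
  proof -
    have "edge \<sigma> ` {1..n} = (\<lambda>i. es ! (i - 1)) ` {1..n}"
      using edge by (intro image_cong) auto
    also have "\<dots> = (\<lambda>i. es ! i) ` ((\<lambda>i. i - 1) ` {1..n})"
      by (simp add: image_image)
    also have "(\<lambda>i. i - 1) ` {1..n} = {..<n}"
      by (auto intro!: image_eqI[of _ _ "Suc _"])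
    also have "(\<lambda>i. es ! i) ` {..<n} = E"
      using es(1,2) by (auto simp: set_conv_nth)
    finally show ?thesis .
  qed
  have "{1..2 * n} \<subseteq> \<sigma> ` {1..2 * n}"
  proof
    fix x assume "x \<in> {1..2 * n}"
    then have "x \<in> verts E"
      using E by (simp add: perfect_matching_def)
    then obtain e where "e \<in> E" "x = fst e \<or> x = snd e"
      unfolding verts_def by blast
    then obtain i where i: "i \<in> {1..n}" "x = fst (edge \<sigma> i) \<or> x = snd (edge \<sigma> i)"
      using img by blast
    then have "x = \<sigma> (2 * i - 1) \<or> x = \<sigma> (2 * i)"
      by (simp add: edge_def)
    moreover have "2 * i - 1 \<in> {1..2 * n}" "2 * i \<in> {1..2 * n}"
      using i(1) by auto
    ultimately show "x \<in> \<sigma> ` {1..2 * n}"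
      by blast
  qed
  moreover have "\<sigma> ` {1..2 * n} \<subseteq> {1..2 * n}"
  proof clarify
    fix x assume x: "x \<in> {1..2 * n}"
    then have "(x - 1) div 2 < n"
      by auto
    then have "es ! ((x - 1) div 2) \<in> E"
      using es by auto
    then show "\<sigma> x \<in> {1..2 * n}"
      using perfect_matching_edgeD[OF E] x by (auto simp: \<sigma>_def)
  qed
  ultimately have "bij_betw \<sigma> {1..2 * n} {1..2 * n}"
    by (simp add: bij_betw_def finite_surj_inj subset_antisym)
  then have perm: "\<sigma> permutes {1..2 * n}"
    by (rule bij_imp_permutes) (auto simp: \<sigma>_def)
  have "\<sigma> (2 * i - 1) < \<sigma> (2 * i)" if "i \<in> {1..n}" for i
    using perfect_matching_edgeD[OF E, of "edge \<sigma> i"] img that by (auto simp: edge_def)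
  moreover have "\<sigma> (2 * i - 1) < \<sigma> (2 * i + 1)" if i: "i \<in> {1..<n}" for i
  proof -
    have "es ! (i - 1) < es ! i"
      using i es(2,3) by (intro sorted_wrt_nth_less[of "(<)" es]) auto
    moreover have "es ! (i - 1) = edge \<sigma> i" "es ! i = edge \<sigma> (i + 1)"
      using edge[of i] edge[of "i + 1"] i by auto
    moreover have "fst (edge \<sigma> i) \<noteq> fst (edge \<sigma> (i + 1))"
      using injD[OF permutes_inj[OF perm], of "2 * i - 1" "2 * (i + 1) - 1"] i by (auto simp: edge_def)
    ultimately show ?thesis
      using i by (auto simp: edge_def less_prod_def)
  qed
  ultimately have "\<sigma> \<in> pfaffian_perms n"
    using perm by (auto simp: pfaffian_perms_def)
  then show ?thesis
    using img by blast
qed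

section \<open>The Pfaffian\<close>

abbreviation pf :: "nat \<Rightarrow> (nat \<times> nat, 'k::field) mpoly" where
  "pf n \<equiv> pfaffian n generic_skew"

lemma prod_single_one: "(\<Prod>i\<in>A. single (m i) 1) = single (\<Sum>i\<in>A. m i) (1 :: 'k::field)"
  for m :: "'b \<Rightarrow> 'v \<Rightarrow>\<^sub>0 nat"
  by (induction A rule: infinite_finite_induct) (simp_all add: mult_single)

lemma edge_monomial_inj: "finite E \<Longrightarrow> finite E' \<Longrightarrow> edge_monomial E = edge_monomial E' \<Longrightarrow> E = E'"
  by (metis keys_edge_monomial)

lemma pf_eq_sum:
  "(pf n :: (nat \<times> nat, 'k::field) mpoly) =
     (\<Sum>\<sigma>\<in>pfaffian_perms n. single (edge_monomial (edge \<sigma> ` {1..n})) (of_int (sign \<sigma>)))"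
  unfolding pfaffian_def
proof (intro sum.cong refl)
  fix \<sigma> assume \<sigma>: "\<sigma> \<in> pfaffian_perms n"
  have "(\<Prod>i=1..n. generic_skew (\<sigma> (2 * i - 1)) (\<sigma> (2 * i))) =
      (\<Prod>i=1..n. single (single (edge \<sigma> i) 1) (1 :: 'k))"
    using \<sigma> by (intro prod.cong refl) (auto simp: generic_skew_def pfaffian_perms_def var_def edge_def)
  also have "\<dots> = single (\<Sum>i=1..n. single (edge \<sigma> i) 1) 1"
    by (rule prod_single_one)
  also have "(\<Sum>i=1..n. single (edge \<sigma> i) 1) = edge_monomial (edge \<sigma> ` {1..n})"
  proof -
    have "inj_on (edge \<sigma>) {1..n}"
      using \<sigma> by (intro inj_on_edge[of _ "{1..2 * n}"]) (simp add: pfaffian_perms_def)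
    then show ?thesis
      by (simp add: edge_monomial_def sum.reindex)
  qed
  finally show "of_int (sign \<sigma>) * (\<Prod>i=1..n. generic_skew (\<sigma> (2 * i - 1)) (\<sigma> (2 * i))) =
      single (edge_monomial (edge \<sigma> ` {1..n})) (of_int (sign \<sigma>) :: 'k)"
    by (simp add: mult_single flip: single_of_int)
qed

lemma finite_pfaffian_perms: "finite (pfaffian_perms n)"
  by (rule finite_subset[OF _ finite_permutations[of "{1..2 * n}"]]) (auto simp: pfaffian_perms_def)

lemma lookup_pf:
  "lookup (pf n :: (nat \<times> nat, 'k::field) mpoly) m =
     (\<Sum>\<sigma>\<in>pfaffian_perms n. if edge_monomial (edge \<sigma> ` {1..n}) = m then of_int (sign \<sigma>) else 0)"
  unfolding pf_eq_sum lookup_sum by (intro sum.cong) (auto simp: lookup_single when_def)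

lemma lookup_pf_edge_monomial:
  assumes \<sigma>: "\<sigma> \<in> pfaffian_perms n"
  shows "lookup (pf n :: (nat \<times> nat, 'k::field) mpoly) (edge_monomial (edge \<sigma> ` {1..n})) = of_int (sign \<sigma>)"
proof -
  have "edge_monomial (edge \<tau> ` {1..n}) = edge_monomial (edge \<sigma> ` {1..n}) \<longleftrightarrow> \<tau> = \<sigma>"
    if "\<tau> \<in> pfaffian_perms n" for \<tau>
    using edge_monomial_inj[of "edge \<tau> ` {1..n}" "edge \<sigma> ` {1..n}"] pfaffian_perms_eqI[OF that \<sigma>] by auto
  then have "lookup (pf n :: (nat \<times> nat, 'k) mpoly) (edge_monomial (edge \<sigma> ` {1..n})) =
      (\<Sum>\<tau>\<in>pfaffian_perms n. if \<tau> = \<sigma> then of_int (sign \<sigma>) else 0)"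
    unfolding lookup_pf by (intro sum.cong) auto
  then show ?thesis
    using \<sigma> finite_pfaffian_perms by simp
qed

lemma lookup_pf_nonzeroD:
  assumes "lookup (pf n :: (nat \<times> nat, 'k::field) mpoly) m \<noteq> 0"
  shows "\<exists>E. perfect_matching {1..2 * n} E \<and> m = edge_monomial E"
proof -
  obtain \<sigma> where "\<sigma> \<in> pfaffian_perms n" "edge_monomial (edge \<sigma> ` {1..n}) = m"
    using assms unfolding lookup_pf
    by (elim sum.not_neutral_contains_not_neutral) (auto split: if_splits)
  then show ?thesis
    using pfaffian_perms_edges by blast
qed

lemma lookup_pf_perfect_matching_nonzero:
  assumes "perfect_matching {1..2 * n} E"
  shows "lookup (pf n :: (nat \<times> nat, 'k::field) mpoly) (edge_monomial E) \<noteq> 0"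
proof -
  obtain \<sigma> where "\<sigma> \<in> pfaffian_perms n" "edge \<sigma> ` {1..n} = E"
    using pfaffian_perms_exists[OF assms] by blast
  then have "lookup (pf n :: (nat \<times> nat, 'k) mpoly) (edge_monomial E) = of_int (sign \<sigma>)"
    using lookup_pf_edge_monomial by blast
  then show ?thesis
    by (cases \<sigma> rule: sign_cases) auto
qed

lemma homogeneous_pf: "homogeneous n (pf n :: (nat \<times> nat, 'k::field) mpoly)"
  unfolding homogeneous_def
proof
  fix m assume "m \<in> keys (pf n :: (nat \<times> nat, 'k) mpoly)"
  then obtain E where E: "perfect_matching {1..2 * n} E" "m = edge_monomial E"
    using lookup_pf_nonzeroD[of n m] by (auto simp: in_keys_iff)
  then show "mdeg m = n"
    using perfect_matching_card[OF E(1)] perfect_matching_finite[OF E(1)] by (simp add: mdeg_edge_monomial)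
qed

lemma pf_nonzero: "(pf n :: (nat \<times> nat, 'k::field) mpoly) \<noteq> 0"
proof -
  obtain E where "perfect_matching {1..2 * n} E"
    using perfect_matching_exists[of "{1..2 * n}"] by auto
  then show ?thesis
    using lookup_pf_perfect_matching_nonzero[of n E] by (metis lookup_zero)
qed

lemma var_square_in_Ann_pf:
  assumes "v \<in> V"
  shows "var v ^ 2 \<in> Ann V (pf n :: (nat \<times> nat, 'k::field) mpoly)"
proof -
  have "var v ^ 2 \<circ>\<^sub>c (pf n :: (nat \<times> nat, 'k) mpoly) = 0"
  proof (rule poly_mapping_eqI)
    fix m
    have "lookup (pf n :: (nat \<times> nat, 'k) mpoly) (single v 2 + m) = 0"
    proof (rule ccontr)
      assume "lookup (pf n :: (nat \<times> nat, 'k) mpoly) (single v 2 + m) \<noteq> 0"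
      then obtain E where E: "perfect_matching {1..2 * n} E" "single v 2 + m = edge_monomial E"
        using lookup_pf_nonzeroD by blast
      have "lookup (edge_monomial E) v \<le> 1"
        using perfect_matching_finite[OF E(1)] by (simp add: lookup_edge_monomial)
      then show False
        unfolding E(2)[symmetric] by (simp add: lookup_add)
    qed
    then show "lookup (var v ^ 2 \<circ>\<^sub>c (pf n :: (nat \<times> nat, 'k) mpoly)) m = lookup 0 m"
      by (simp add: var_power lookup_single_contract)
  qed
  then show ?thesis
    using assms by (simp add: Ann_def power_in_polys var_in_polys)
qed

lemma lookup_pf_add_nonzeroD:
  assumes \<mu>: "perfect_matching T \<mu>" "T \<subseteq> {1..2 * n}"
    and nz: "lookup (pf n :: (nat \<times> nat, 'k::field) mpoly) (edge_monomial \<mu> + m) \<noteq> 0"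
  shows "\<exists>\<rho>. perfect_matching ({1..2 * n} - T) \<rho> \<and> m = edge_monomial \<rho>"
proof -
  have fin: "finite \<mu>"
    using perfect_matching_finite[OF \<mu>(1)] \<mu>(2) finite_subset by blast
  obtain E where E: "perfect_matching {1..2 * n} E" "edge_monomial \<mu> + m = edge_monomial E"
    using lookup_pf_nonzeroD[OF nz] by blast
  have finE: "finite E"
    using perfect_matching_finite[OF E(1)] by simp
  have "\<mu> \<subseteq> E" "m = edge_monomial (E - \<mu>)"
    using edge_monomial_eq_addD[OF finE E(2)] fin by simp_all
  moreover have "verts \<mu> = T"
    using \<mu>(1) by (simp add: perfect_matching_def)
  ultimately show ?thesis
    using perfect_matching_Diff[OF E(1)] by blast
qed

text \<open>
  A permutation \<open>\<tau>\<close> of \<open>T\<close> mapping the edges of \<open>\<mu>\<close> monotonically onto those of \<open>\<mu>'\<close> changes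
  the sign of every perfect matching containing \<open>\<mu>\<close> by the same factor.
\<close>

lemma matching_sign_ratio:
  fixes T :: "nat set"
  assumes \<mu>: "perfect_matching T \<mu>" and \<mu>': "perfect_matching T \<mu>'" and T: "T \<subseteq> {1..2 * n}"
  shows "\<exists>\<epsilon>::int. \<forall>\<rho>. perfect_matching ({1..2 * n} - T) \<rho> \<longrightarrow>
    lookup (pf n :: (nat \<times> nat, 'k::field) mpoly) (edge_monomial (\<mu>' \<union> \<rho>)) =
      of_int \<epsilon> * lookup (pf n) (edge_monomial (\<mu> \<union> \<rho>))"
proof -
  have finT: "finite T"
    using T finite_subset by blast
  have fin: "finite \<mu>" "finite \<mu>'"
    using perfect_matching_finite \<mu> \<mu>' finT by blast+
  have "card \<mu> = card \<mu>'"
    using perfect_matching_card[OF \<mu> finT] perfect_matching_card[OF \<mu>' finT] by simp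
  then obtain g where g: "bij_betw g \<mu> \<mu>'"
    using finite_same_card_bij[OF fin] by blast
  define edge_at where "edge_at x = (THE e. e \<in> \<mu> \<and> x \<in> {fst e, snd e})" for x
  have edge_at: "edge_at x = e" if "e \<in> \<mu>" "x \<in> {fst e, snd e}" for x e
    unfolding edge_at_def
  proof (rule the_equality)
    show "e \<in> \<mu> \<and> x \<in> {fst e, snd e}"
      using that by blast
    fix e' assume "e' \<in> \<mu> \<and> x \<in> {fst e', snd e'}"
    then show "e' = e"
      using perfect_matching_disjointD[OF \<mu> _ that(1) _ that(2)] by blast
  qed
  define \<tau> where "\<tau> x = (if x \<in> T then
      (if x = fst (edge_at x) then fst (g (edge_at x)) else snd (g (edge_at x))) else x)" for x
  have \<tau>: "\<tau> (fst e) = fst (g e)" "\<tau> (snd e) = snd (g e)" if e: "e \<in> \<mu>" for e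
    using perfect_matching_edgeD[OF \<mu> e] edge_at[OF e, of "fst e"] edge_at[OF e, of "snd e"]
    by (auto simp: \<tau>_def)
  have "T \<subseteq> \<tau> ` T"
  proof
    fix x assume "x \<in> T"
    then have "x \<in> verts \<mu>'"
      using \<mu>' by (simp add: perfect_matching_def)
    then obtain e' where e': "e' \<in> \<mu>'" "x = fst e' \<or> x = snd e'"
      unfolding verts_def by blast
    then obtain e where e: "e \<in> \<mu>" "g e = e'"
      using g unfolding bij_betw_def by blast
    then have "x = \<tau> (fst e) \<or> x = \<tau> (snd e)"
      using e'(2) \<tau> by simp
    then show "x \<in> \<tau> ` T"
      using perfect_matching_edgeD[OF \<mu> e(1)] by blast
  qed
  moreover from this have "\<tau> ` T = T"
    using finT by (metis card_image_le card_subset_eq finite_imageI card_mono le_antisym)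
  ultimately have "bij_betw \<tau> T T"
    using finT by (simp add: bij_betw_def finite_surj_inj)
  then have perm_T: "\<tau> permutes T"
    by (rule bij_imp_permutes) (simp add: \<tau>_def)
  then have perm: "\<tau> permutes {1..2 * n}"
    using permutes_subset T by blast
  have "lookup (pf n :: (nat \<times> nat, 'k) mpoly) (edge_monomial (\<mu>' \<union> \<rho>)) =
      of_int (sign \<tau>) * lookup (pf n) (edge_monomial (\<mu> \<union> \<rho>))"
    if \<rho>: "perfect_matching ({1..2 * n} - T) \<rho>" for \<rho>
  proof -
    have "T \<union> ({1..2 * n} - T) = {1..2 * n}"
      using T by blast
    then have pm: "perfect_matching {1..2 * n} (\<mu> \<union> \<rho>)" "perfect_matching {1..2 * n} (\<mu>' \<union> \<rho>)"
      using perfect_matching_Un[OF \<mu> \<rho>] perfect_matching_Un[OF \<mu>' \<rho>] by auto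
    obtain \<sigma> where \<sigma>: "\<sigma> \<in> pfaffian_perms n" "edge \<sigma> ` {1..n} = \<mu> \<union> \<rho>"
      using pfaffian_perms_exists[OF pm(1)] by blast
    obtain \<sigma>' where \<sigma>': "\<sigma>' \<in> pfaffian_perms n" "edge \<sigma>' ` {1..n} = \<mu>' \<union> \<rho>"
      using pfaffian_perms_exists[OF pm(2)] by blast
    have \<sigma>_perm: "\<sigma> permutes {1..2 * n}" "\<sigma>' permutes {1..2 * n}"
      using \<sigma> \<sigma>' by (simp_all add: pfaffian_perms_def)
    have "edge (\<tau> \<circ> \<sigma>) ` {1..n} = map_prod \<tau> \<tau> ` (edge \<sigma> ` {1..n})"
      by (simp add: image_image edge_def)
    also have "\<dots> = map_prod \<tau> \<tau> ` \<mu> \<union> map_prod \<tau> \<tau> ` \<rho>"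
      unfolding \<sigma>(2) image_Un ..
    also have "map_prod \<tau> \<tau> ` \<mu> = g ` \<mu>"
      using \<tau> by (intro image_cong refl) (simp add: prod_eq_iff)
    also have "g ` \<mu> = \<mu>'"
      using g by (simp add: bij_betw_def)
    also have "map_prod \<tau> \<tau> ` \<rho> = (\<lambda>e. e) ` \<rho>"
      using perfect_matching_edgeD[OF \<rho>] by (intro image_cong refl) (simp add: prod_eq_iff \<tau>_def)
    finally have "edge (\<tau> \<circ> \<sigma>) ` {1..n} = edge \<sigma>' ` {1..n}"
      by (simp only: image_ident \<sigma>'(2))
    then have "sign (\<tau> \<circ> \<sigma>) = sign \<sigma>'"
      by (rule sign_eq_of_edges_eq[OF permutes_compose[OF \<sigma>_perm(1) perm] \<sigma>_perm(2)])
    moreover have "sign (\<tau> \<circ> \<sigma>) = sign \<tau> * sign \<sigma>"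
      using perm \<sigma>_perm(1) permutation_permutes by (blast intro: sign_compose)
    ultimately show ?thesis
      using lookup_pf_edge_monomial[OF \<sigma>(1), where 'k = 'k] lookup_pf_edge_monomial[OF \<sigma>'(1), where 'k = 'k] \<sigma>(2) \<sigma>'(2)
      by (metis of_int_mult)
  qed
  then show ?thesis
    by blast
qed

lemma contract_pf_ratio:
  assumes \<mu>: "perfect_matching T \<mu>" and \<mu>': "perfect_matching T \<mu>'" and T: "T \<subseteq> {1..2 * n}"
  shows "\<exists>c. single (edge_monomial \<mu>') 1 \<circ>\<^sub>c (pf n :: (nat \<times> nat, 'k::field) mpoly) =
    single 0 c * (single (edge_monomial \<mu>) 1 \<circ>\<^sub>c pf n)"
proof -
  obtain \<epsilon> :: int where \<epsilon>: "\<And>\<rho>. perfect_matching ({1..2 * n} - T) \<rho> \<Longrightarrow>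
    lookup (pf n :: (nat \<times> nat, 'k) mpoly) (edge_monomial (\<mu>' \<union> \<rho>)) =
      of_int \<epsilon> * lookup (pf n) (edge_monomial (\<mu> \<union> \<rho>))"
    using matching_sign_ratio[OF \<mu> \<mu>' T, where 'k = 'k] by blast
  have finT: "finite T"
    using T finite_subset by blast
  have "lookup (pf n :: (nat \<times> nat, 'k) mpoly) (edge_monomial \<mu>' + m) =
      of_int \<epsilon> * lookup (pf n) (edge_monomial \<mu> + m)" for m
  proof (cases "\<exists>\<rho>. perfect_matching ({1..2 * n} - T) \<rho> \<and> m = edge_monomial \<rho>")
    case True
    then obtain \<rho> where \<rho>: "perfect_matching ({1..2 * n} - T) \<rho>" "m = edge_monomial \<rho>"
      by blast
    have "edge_monomial (\<nu> \<union> \<rho>) = edge_monomial \<nu> + m" if "perfect_matching T \<nu>" for \<nu>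
      unfolding \<rho>(2)
    proof (rule edge_monomial_Un)
      show "finite \<nu>" "finite \<rho>"
        using perfect_matching_finite that \<rho>(1) finT by blast+
      show "\<nu> \<inter> \<rho> = {}"
        using perfect_matching_edgeD[OF that] perfect_matching_edgeD[OF \<rho>(1)] by blast
    qed
    then show ?thesis
      using \<epsilon>[OF \<rho>(1)] \<mu> \<mu>' by simp
  next
    case False
    then have "lookup (pf n :: (nat \<times> nat, 'k) mpoly) (edge_monomial \<mu>' + m) = 0"
      "lookup (pf n :: (nat \<times> nat, 'k) mpoly) (edge_monomial \<mu> + m) = 0"
      using lookup_pf_add_nonzeroD[OF \<mu>' T] lookup_pf_add_nonzeroD[OF \<mu> T] by blast+
    then show ?thesis
      by simp
  qed
  then have "single (edge_monomial \<mu>') 1 \<circ>\<^sub>c (pf n :: (nat \<times> nat, 'k) mpoly) =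
      single 0 (of_int \<epsilon>) * (single (edge_monomial \<mu>) 1 \<circ>\<^sub>c pf n)"
    by (intro poly_mapping_eqI) (simp only: lookup_single_contract lookup_scale mult_1_left)
  then show ?thesis ..
qed

definition even_subsets :: "nat \<Rightarrow> nat set set" where
  "even_subsets m = {T. T \<subseteq> {1..m} \<and> even (card T)}"

lemma finite_even_subsets: "finite (even_subsets m)"
  unfolding even_subsets_def by (rule finite_subset[of _ "Pow {1..m}"]) auto

lemma card_even_subsets:
  assumes "m \<ge> 1"
  shows "card (even_subsets m) = 2 ^ (m - 1)"
proof -
  have "bij_betw (\<lambda>T. T - {1}) (even_subsets m) (Pow {2..m})"
  proof (rule bij_betw_byWitness[where f' = "\<lambda>S. if even (card S) then S else insert 1 S"])
    show "\<forall>T\<in>even_subsets m. (if even (card (T - {1})) then T - {1} else insert 1 (T - {1})) = T"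
    proof
      fix T assume T: "T \<in> even_subsets m"
      then have fin: "finite T"
        using finite_subset by (auto simp: even_subsets_def)
      show "(if even (card (T - {1})) then T - {1} else insert 1 (T - {1})) = T"
      proof (cases "1 \<in> T")
        case True
        then have "odd (card (T - {1}))"
          using T card_Suc_Diff1[OF fin True] by (metis (no_types, lifting) even_Suc even_subsets_def mem_Collect_eq)
        then show ?thesis
          using True by auto
      next
        case False
        then show ?thesis
          using T by (simp add: even_subsets_def)
      qed
    qed
    show "\<forall>S\<in>Pow {2..m}. (if even (card S) then S else insert 1 S) - {1} = S"
      by auto
    show "(\<lambda>T. T - {1}) ` even_subsets m \<subseteq> Pow {2..m}"
    proof (intro image_subsetI PowI subsetI)
      fix T x assume "T \<in> even_subsets m" "x \<in> T - {1}"
      then have "x \<in> {1..m}" "x \<noteq> 1"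
        by (auto simp: even_subsets_def)
      then show "x \<in> {2..m}"
        by simp
    qed
    show "(\<lambda>S. if even (card S) then S else insert 1 S) ` Pow {2..m} \<subseteq> even_subsets m"
    proof clarify
      fix S assume S: "S \<subseteq> {2..m}"
      then have "finite S" "1 \<notin> S"
        using finite_subset by auto
      moreover have "S \<subseteq> {1..m}"
        using S by fastforce
      ultimately show "(if even (card S) then S else insert 1 S) \<in> even_subsets m"
        using assms by (auto simp: even_subsets_def)
    qed
  qed
  then have "card (even_subsets m) = card (Pow {2..m})"
    by (rule bij_betw_same_card)
  then show ?thesis
    using assms by (simp add: card_Pow)
qed

definition some_matching :: "nat set \<Rightarrow> (nat \<times> nat) set" where
  "some_matching T = (SOME E. perfect_matching T E)"

lemma some_matching:
  assumes "T \<in> even_subsets m"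
  shows "perfect_matching T (some_matching T)"
proof -
  have "T \<subseteq> {1..m}" "even (card T)"
    using assms by (simp_all add: even_subsets_def)
  moreover from this(1) have "finite T"
    by (rule finite_subset) simp
  ultimately show ?thesis
    unfolding some_matching_def by (intro someI_ex[OF perfect_matching_exists])
qed

lemma finite_skew_vars: "finite (skew_vars m)"
  by (rule finite_subset[of _ "{1..m} \<times> {1..m}"]) (auto simp: skew_vars_def)

lemma perfect_matching_subset_skew_vars: "perfect_matching T E \<Longrightarrow> T \<subseteq> {1..m} \<Longrightarrow> E \<subseteq> skew_vars m"
  using perfect_matching_edgeD[of T E] by (fastforce simp: skew_vars_def)

lemma dim_Ann_pf_le:
  "mpoly.dim (Ann (skew_vars (2 * n)) (pf n :: (nat \<times> nat, 'k::field) mpoly) \<inter> forms (skew_vars (2 * n)) s) +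
     card {T \<in> even_subsets (2 * n). card T = 2 * s} \<le>
   mpoly.dim (forms (skew_vars (2 * n)) s :: (nat \<times> nat, 'k::field) mpoly set)"
proof -
  let ?V = "skew_vars (2 * n)" and ?B = "{T \<in> even_subsets (2 * n). card T = 2 * s}"
  let ?h = "\<lambda>T. single (edge_monomial (some_matching T)) 1 :: (nat \<times> nat, 'k) mpoly"
  have fin: "finite ?B"
    using finite_even_subsets by simp
  obtain C where C: "finite C" "forms ?V s \<subseteq> mpoly.span (C :: (nat \<times> nat, 'k) mpoly set)"
    using finite_span_forms[OF finite_skew_vars subset_refl] .
  have "card ?B + mpoly.dim (Ann ?V (pf n :: (nat \<times> nat, 'k) mpoly) \<inter> forms ?V s) \<le>
      mpoly.dim (forms ?V s :: (nat \<times> nat, 'k) mpoly set)"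
  proof (rule mpoly.card_add_dim_le_dim[OF _ Int_lower2 C fin, where h = ?h])
    show "mpoly.subspace (Ann ?V (pf n :: (nat \<times> nat, 'k) mpoly) \<inter> forms ?V s)"
      by (intro mpoly.subspace_inter subspace_ideal[OF ideal_Ann] subspace_forms)
    show "?h ` ?B \<subseteq> forms ?V s"
    proof clarify
      fix T assume T: "T \<in> even_subsets (2 * n)" "card T = 2 * s"
      have pm: "perfect_matching T (some_matching T)" and sub: "T \<subseteq> {1..2 * n}"
        using some_matching[OF T(1)] T(1) by (auto simp: even_subsets_def)
      then have "finite T"
        using finite_subset by blast
      then have "finite (some_matching T)" "card (some_matching T) = s"
        using perfect_matching_finite[OF pm] perfect_matching_card[OF pm] T(2) by auto
      then show "?h T \<in> forms ?V s"
        using perfect_matching_subset_skew_vars[OF pm sub]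
        by (simp add: forms_def single_in_polys homogeneous_single mdeg_edge_monomial)
    qed
    fix c assume "(\<Sum>T\<in>?B. single 0 (c T) * ?h T) \<in> Ann ?V (pf n) \<inter> forms ?V s"
    then have "(\<Sum>T\<in>?B. single 0 (c T) * ?h T) \<circ>\<^sub>c pf n = 0"
      by (simp add: Ann_def)
    then have sum0: "(\<Sum>T\<in>?B. c T * lookup (pf n) (edge_monomial (some_matching T) + m)) = 0" for m
    proof -
      assume "(\<Sum>T\<in>?B. single 0 (c T) * ?h T) \<circ>\<^sub>c pf n = 0"
      then have "lookup ((\<Sum>T\<in>?B. single 0 (c T) * ?h T) \<circ>\<^sub>c pf n) m = 0"
        by simp
      then show ?thesis
        by (simp add: contract_sum lookup_sum mult_single lookup_single_contract)
    qed
    show "\<forall>T\<in>?B. c T = 0"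
    proof
      fix T assume T: "T \<in> ?B"
      then have sub: "T \<subseteq> {1..2 * n}" and pm: "perfect_matching T (some_matching T)"
        using some_matching[of T "2 * n"] by (auto simp: even_subsets_def)
      have "card ({1..2 * n} - T) = 2 * n - card T"
        using sub finite_subset by (subst card_Diff_subset) auto
      then have "even (card ({1..2 * n} - T))"
        using T by simp
      then obtain \<rho> where \<rho>: "perfect_matching ({1..2 * n} - T) \<rho>"
        using perfect_matching_exists[of "{1..2 * n} - T"] by auto
      have zero: "lookup (pf n :: (nat \<times> nat, 'k) mpoly) (edge_monomial (some_matching T') + edge_monomial \<rho>) = 0"
        if T': "T' \<in> ?B" "T' \<noteq> T" for T'
      proof (rule ccontr)
        assume nz: "lookup (pf n :: (nat \<times> nat, 'k) mpoly) (edge_monomial (some_matching T') + edge_monomial \<rho>) \<noteq> 0"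
        have sub': "T' \<subseteq> {1..2 * n}" and pm': "perfect_matching T' (some_matching T')"
          using some_matching[of T' "2 * n"] T' by (auto simp: even_subsets_def)
        obtain \<rho>' where \<rho>': "perfect_matching ({1..2 * n} - T') \<rho>'" "edge_monomial \<rho> = edge_monomial \<rho>'"
          using lookup_pf_add_nonzeroD[OF pm' sub' nz] by blast
        then have "\<rho> = \<rho>'"
          using perfect_matching_finite[OF \<rho>] perfect_matching_finite[OF \<rho>'(1)] edge_monomial_inj by blast
        then have "{1..2 * n} - T = {1..2 * n} - T'"
          using \<rho> \<rho>'(1) by (simp add: perfect_matching_def)
        then show False
          using sub sub' T'(2) by blast
      qed
      have "(\<Sum>T'\<in>?B. c T' * lookup (pf n) (edge_monomial (some_matching T') + edge_monomial \<rho>)) =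
          (\<Sum>T'\<in>?B. if T' = T then c T * lookup (pf n) (edge_monomial (some_matching T) + edge_monomial \<rho>) else 0)"
        using zero by (intro sum.cong) auto
      then have "c T * lookup (pf n) (edge_monomial (some_matching T) + edge_monomial \<rho>) = 0"
        using sum0[of "edge_monomial \<rho>"] T fin by simp
      moreover have "edge_monomial (some_matching T) + edge_monomial \<rho> = edge_monomial (some_matching T \<union> \<rho>)"
      proof (rule edge_monomial_Un[symmetric])
        show "finite (some_matching T)" "finite \<rho>"
          using perfect_matching_finite[OF pm] perfect_matching_finite[OF \<rho>] sub finite_subset by auto
        show "some_matching T \<inter> \<rho> = {}"
          using perfect_matching_edgeD[OF pm] perfect_matching_edgeD[OF \<rho>] by blast
      qed
      moreover have "perfect_matching {1..2 * n} (some_matching T \<union> \<rho>)"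
        using perfect_matching_Un[OF pm \<rho>] sub by (simp add: Un_absorb1)
      ultimately show "c T = 0"
        using lookup_pf_perfect_matching_nonzero[of n "some_matching T \<union> \<rho>", where 'k = 'k] by simp
    qed
  qed
  then show ?thesis
    by simp
qed

lemma sum_card_even_subsets:
  assumes "n \<ge> 1"
  shows "(\<Sum>s\<le>n. card {T \<in> even_subsets (2 * n). card T = 2 * s}) = 2 ^ (2 * n - 1)"
proof -
  have "card (\<Union>s\<in>{..n}. {T \<in> even_subsets (2 * n). card T = 2 * s}) =
      (\<Sum>s\<le>n. card {T \<in> even_subsets (2 * n). card T = 2 * s})"
    using finite_even_subsets by (intro card_UN_disjoint) auto
  moreover have "(\<Union>s\<in>{..n}. {T \<in> even_subsets (2 * n). card T = 2 * s}) = even_subsets (2 * n)"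
  proof
    show "even_subsets (2 * n) \<subseteq> (\<Union>s\<in>{..n}. {T \<in> even_subsets (2 * n). card T = 2 * s})"
    proof
      fix T assume T: "T \<in> even_subsets (2 * n)"
      then have "card T \<le> 2 * n" "card T = 2 * (card T div 2)"
        using card_mono[of "{1..2 * n}" T] by (auto simp: even_subsets_def)
      then show "T \<in> (\<Union>s\<in>{..n}. {T \<in> even_subsets (2 * n). card T = 2 * s})"
        using T by auto
    qed
  qed auto
  ultimately show ?thesis
    using card_even_subsets[of "2 * n"] assms by simp
qed

lemma cactus_rank_pf_ge:
  assumes "n \<ge> 1"
  shows "enat (2 ^ (2 * n - 2)) \<le> cactus_rank (skew_vars (2 * n)) (pf n :: (nat \<times> nat, 'k::field) mpoly)"
proof (rule cactus_rank_ge[OF finite_skew_vars var_square_in_Ann_pf dim_Ann_pf_le, where n = "n - 1"])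
  have "2 * 2 ^ (2 * n - 2) = (2 :: nat) ^ Suc (2 * n - 2)"
    by simp
  also have "Suc (2 * n - 2) = 2 * n - 1"
    using assms by simp
  also have "2 ^ (2 * n - 1) = (\<Sum>s\<le>n. card {T \<in> even_subsets (2 * n). card T = 2 * s})"
    using sum_card_even_subsets[OF assms] by simp
  finally show "2 * 2 ^ (2 * n - 2) \<le> (\<Sum>s\<le>Suc (n - 1). card {T \<in> even_subsets (2 * n). card T = 2 * s})"
    using assms by simp
qed

lemma cactus_rank_pf_le:
  assumes "n \<ge> 1"
  shows "cactus_rank (skew_vars (2 * n)) (pf n :: (nat \<times> nat, 'k::field) mpoly) \<le> enat (2 ^ (2 * n - 1))"
proof -
  let ?V = "skew_vars (2 * n)" and ?v = "(1, 2) :: nat \<times> nat" and ?F = "pf n :: (nat \<times> nat, 'k) mpoly"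
  define G where "G = (\<lambda>T. var ?v ^ (card T div 2) * (single (edge_monomial (some_matching T)) 1 \<circ>\<^sub>c ?F)) ` even_subsets (2 * n)"
  show ?thesis
  proof (rule cactus_rank_le[OF finite_skew_vars _ homogeneous_pf pf_nonzero, of ?v])
    show "?v \<in> ?V"
      using assms by (simp add: skew_vars_def)
    show "var w ^ 2 \<in> Ann ?V ?F" if "w \<in> ?V - {?v}" for w
      using that by (intro var_square_in_Ann_pf) simp
    show "finite G"
      unfolding G_def using finite_even_subsets by simp
    have "card G \<le> card (even_subsets (2 * n))"
      unfolding G_def by (rule card_image_le[OF finite_even_subsets])
    then show "card G \<le> 2 ^ (2 * n - 1)"
      using card_even_subsets[of "2 * n"] assms by simp
    fix d a assume a: "a \<in> monomials ?V d"
    define i a' where "i = lookup a ?v" and "a' = a - single ?v i"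
    have a_eq: "a = single ?v i + a'"
      unfolding a'_def i_def by (rule monomial_split) (auto simp: lookup_single when_def)
    have a'v: "lookup a' ?v = 0"
      by (simp add: a'_def i_def lookup_minus)
    have deg: "i + mdeg a' = d"
      using a a_eq mdeg_add[of "single ?v i" a'] by (simp add: monomials_def)
    have eq: "single a 1 \<circ>\<^sub>c (var ?v ^ d * ?F) = var ?v ^ mdeg a' * (single a' 1 \<circ>\<^sub>c ?F)"
      using monomial_contract_var_power_mult[of a' ?v i d 1 ?F, OF a'v] deg a_eq by auto
    show "single a 1 \<circ>\<^sub>c (var ?v ^ d * ?F) \<in> mpoly.span G"
    proof (cases "single a' 1 \<circ>\<^sub>c ?F = 0")
      case True
      then show ?thesis
        unfolding eq by (simp add: mpoly.span_zero)
    next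
      case False
      then obtain m where "lookup (single a' 1 \<circ>\<^sub>c ?F) m \<noteq> 0"
        by (metis lookup_zero poly_mapping_eqI)
      then have "lookup ?F (a' + m) \<noteq> 0"
        by (simp add: lookup_single_contract)
      then obtain E where E: "perfect_matching {1..2 * n} E" "a' + m = edge_monomial E"
        using lookup_pf_nonzeroD by blast
      have finE: "finite E"
        using perfect_matching_finite[OF E(1)] by simp
      define \<mu> T where "\<mu> = keys a'" and "T = verts \<mu>"
      have \<mu>: "\<mu> \<subseteq> E" "a' = edge_monomial \<mu>"
        using edge_monomial_eq_addD[OF finE E(2)] by (simp_all add: \<mu>_def)
      have pm: "perfect_matching T \<mu>"
        unfolding T_def by (rule perfect_matching_subset[OF E(1) \<mu>(1)])
      have "verts E = {1..2 * n}"
        using E(1) by (simp add: perfect_matching_def)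
      then have sub: "T \<subseteq> {1..2 * n}"
        using \<mu>(1) unfolding T_def verts_def by blast
      then have finT: "finite T"
        using finite_subset by blast
      have card: "card T = 2 * card \<mu>"
        by (rule perfect_matching_card[OF pm finT])
      then have T: "T \<in> even_subsets (2 * n)"
        using sub by (simp add: even_subsets_def)
      have "mdeg a' = mdeg (edge_monomial \<mu>)"
        by (rule arg_cong[OF \<mu>(2)])
      also have "\<dots> = card T div 2"
        using card mdeg_edge_monomial[of \<mu>] finite_subset[OF \<mu>(1) finE] by simp
      finally have "mdeg a' = card T div 2" .
      moreover obtain c where "single a' 1 \<circ>\<^sub>c ?F = single 0 c * (single (edge_monomial (some_matching T)) 1 \<circ>\<^sub>c ?F)"
        using contract_pf_ratio[OF some_matching[OF T] pm sub, where 'k = 'k] \<mu>(2) by auto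
      ultimately have "single a 1 \<circ>\<^sub>c (var ?v ^ d * ?F) =
          single 0 c * (var ?v ^ (card T div 2) * (single (edge_monomial (some_matching T)) 1 \<circ>\<^sub>c ?F))"
        using eq by (simp add: mult.left_commute)
      also have "\<dots> \<in> mpoly.span G"
        unfolding G_def using T by (intro mpoly.span_scale mpoly.span_base) blast
      finally show ?thesis .
    qed
  qed
qed

theorem corollary4p12:
  fixes n :: nat
  assumes "CHAR('k::field) = 0 \<or> CHAR('k) > 2"
    and "n \<ge> 1"
  shows "2 ^ (2*n - 2) \<le>
           cactus_rank (skew_vars (2*n)) (pfaffian n generic_skew :: (nat \<times> nat, 'k) mpoly)
       \<and> cactus_rank (skew_vars (2*n)) (pfaffian n generic_skew :: (nat \<times> nat, 'k) mpoly)
           \<le> 2 ^ (2*n - 1)"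
proof -
  have "enat (2 ^ k) = 2 ^ k" for k :: nat
    by (metis of_nat_eq_enat of_nat_numeral of_nat_power)
  then show ?thesis
    using cactus_rank_pf_ge[OF assms(2), where 'k = 'k] cactus_rank_pf_le[OF assms(2), where 'k = 'k] by simp
qed

end
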